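(* Let $r>4$, $1<k_1,k_2<r-1$, $\lambda_1\in\Lambda_n^{(k_1,r)}$ and $\lambda_2\in\Lambda_n^{(k_2,r)}$, neither of trivial type. Then (1) $\rho_{\lambda_1}^{(k_1,r)}$ is equivalent to $\psi\otimes\rho_{\lambda_2}^{(k_2,r)}$ for some character $\psi$ of $B_n$ if and only if $\lambda_1=\lambda_2$; (2) $\rho_{\lambda_1}^{(k_1,r)}$ is equivalent to $\psi\otimes(\rho_{\lambda_2}^{(k_2,r)})^*$ for some character $\psi$ of $B_n$ if and only if $\lambda_1=(\lambda_2)_r^*$.
   Context: Fix an integer $r\ge 3$ and $q=e^{\pm2\pi i/r}$, $q^{1/2}=e^{\pm\pi i/r}$, quantum integers $[m]=\frac{q^{m/2}-q^{-m/2}}{q^{1/2}-q^{-1/2}}$. A Young diagram $\lambda=[\lambda_1,\dots,\lambda_k]$, $\lambda_1\ge\dots\ge\lambda_k\ge0$, has $n=\sum\lambda_i$ boxes (diagrams differing only by empty rows are identified); standard tableaux are fillings by $1,\dots,n$ increasing in rows and columns. For $r\ge k+1$, $\lambda$ is $(k,r)$-admissible if $\lambda_1-\lambda_k\le r-k$; $\Lambda_n^{(k,r)}$ is the set of such diagrams with $n$ boxes. For a standard tableau $t$, $t^{(i)}$ deletes boxes containing $n,\dots,n-i+1$; $t$ is $(k,r)$-admissible if every $t^{(i)}$ has admissible shape. With entries $m,m'$ in rows $r_1,r_2$, columns $c_1,c_2$: $d_{t,m,m'}=(c_1-c_2)-(r_1-r_2)$; with $d=d_{t,i,i+1}$, $\alpha_{t,i}=\frac{[d+1]}{[2][d]}$,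 $\beta_{t,i}=\sqrt{\alpha_{t,i}(1-\alpha_{t,i})}$. $V_\lambda^{(k,r)}$ has orthonormal basis $\{v_t\}$ over admissible standard tableaux of shape $\lambda$; $E_iv_t=\alpha_{t,i}v_t+\beta_{t,i}v_{s_i(t)}$ if $s_i(t)$ ($i,i+1$ swapped) is an admissible standard tableau, else $E_iv_t=\alpha_{t,i}v_t$. Sector: $\rho_\lambda^{(k,r)}(\sigma_i)=q\,\mathrm{Id}-(1+q)E_i$. $\lambda$ is of trivial type if it is a single row or a single column or $k=r-1$. The $r$-tile of $\lambda$ with $k$ rows ($l=r-k$) is $T_\lambda=(t_{ij})_{k\times l}$, $t_{ij}=\lfloor(\lambda_i+l-j)/l\rfloor$; the $r$-conjugate $\lambda_r^*$ is the diagram whose $i$-th row length is the $i$-th row sum of the transpose of $T_\lambda$. $\rho^*$ denotes the contragredient representation. *)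

theory Defs
  imports Complex_Main "Jordan_Normal_Form.Gauss_Jordan_Elimination"
begin

(* A Young diagram is a list of its nonzero row lengths, weakly decreasing;
   this realises the identification of diagrams differing by empty rows. *)
definition young :: "nat list \<Rightarrow> bool" where
  "young lam \<longleftrightarrow> sorted_wrt (\<ge>) lam \<and> (\<forall>x\<in>set lam. 0 < x)"

definition rowlen :: "nat list \<Rightarrow> nat \<Rightarrow> nat" where
  "rowlen lam i = (if i < length lam then lam ! i else 0)"

definition kr_admissible :: "nat \<Rightarrow> nat \<Rightarrow> nat list \<Rightarrow> bool" where
  "kr_admissible k r lam \<longleftrightarrow> young lam \<and> length lam \<le> k \<and>
     int (rowlen lam 0) - int (rowlen lam (k - 1)) \<le> int r - int k"

definition Lambda :: "nat \<Rightarrow> nat \<Rightarrow> nat \<Rightarrow> nat list set" where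
  "Lambda n k r = {lam. kr_admissible k r lam \<and> sum_list lam = n}"

definition trivial_type :: "nat \<Rightarrow> nat \<Rightarrow> nat list \<Rightarrow> bool" where
  "trivial_type k r lam \<longleftrightarrow> length lam \<le> 1 \<or> (\<forall>x\<in>set lam. x = 1) \<or> k = r - 1"

(* A tableau with entries 1..n is encoded by the word w of length n with
   w ! (m-1) = row (0-indexed) of the box containing m. *)
definition cnt :: "nat \<Rightarrow> nat list \<Rightarrow> nat" where
  "cnt j w = length (filter (\<lambda>x. x = j) w)"

definition has_shape :: "nat list \<Rightarrow> nat list \<Rightarrow> bool" where
  "has_shape w lam \<longleftrightarrow> (\<forall>j. cnt j w = rowlen lam j)"

(* the filling is standard iff every truncation t^{(i)} is a Young diagram *)
definition standard :: "nat list \<Rightarrow> bool" where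
  "standard w \<longleftrightarrow> (\<forall>p\<le>length w. \<forall>j. cnt (Suc j) (take p w) \<le> cnt j (take p w))"

definition shape :: "nat list \<Rightarrow> nat list" where
  "shape w = filter (\<lambda>x. 0 < x) (map (\<lambda>j. cnt j w) [0..<Suc (Max (insert 0 (set w)))])"

definition adm_tableau :: "nat \<Rightarrow> nat \<Rightarrow> nat list \<Rightarrow> bool" where
  "adm_tableau k r w \<longleftrightarrow> standard w \<and> (\<forall>i\<le>length w. kr_admissible k r (shape (take (length w - i) w)))"

(* enumeration of the (k,r)-admissible standard tableaux of shape lam;
   such tableaux only use rows 0..k-1 *)
definition tabs :: "nat \<Rightarrow> nat \<Rightarrow> nat list \<Rightarrow> nat list list" where
  "tabs k r lam = filter (\<lambda>w. adm_tableau k r w \<and> has_shape w lam)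
                    (List.n_lists (sum_list lam) [0..<k])"

(* row and column (0-indexed) of the entry m (1 <= m <= n) *)
definition trow :: "nat list \<Rightarrow> nat \<Rightarrow> int" where
  "trow w m = int (w ! (m - 1))"

definition tcol :: "nat list \<Rightarrow> nat \<Rightarrow> int" where
  "tcol w m = int (cnt (w ! (m - 1)) (take (m - 1) w))"

definition dist :: "nat list \<Rightarrow> nat \<Rightarrow> nat \<Rightarrow> int" where
  "dist w m m' = (tcol w m - tcol w m') - (trow w m - trow w m')"

definition swap_tab :: "nat \<Rightarrow> nat list \<Rightarrow> nat list" where
  "swap_tab i w = w[i - 1 := w ! i, i := w ! (i - 1)]"

(* quantum integer, with q12 = q^{1/2} *)
definition qint :: "complex \<Rightarrow> int \<Rightarrow> complex" where
  "qint q12 m = (q12 powi m - q12 powi (- m)) / (q12 - inverse q12)"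

definition alpha :: "complex \<Rightarrow> nat list \<Rightarrow> nat \<Rightarrow> complex" where
  "alpha q12 w i = (let d = dist w i (Suc i) in qint q12 (d + 1) / (qint q12 2 * qint q12 d))"

definition beta :: "complex \<Rightarrow> nat list \<Rightarrow> nat \<Rightarrow> complex" where
  "beta q12 w i = csqrt (alpha q12 w i * (1 - alpha q12 w i))"

(* matrix of E_i in the basis (v_t), t ranging over tabs k r lam;
   entry (a,b) is the coefficient of v_{T!a} in E_i v_{T!b} *)
definition E_mat :: "complex \<Rightarrow> nat \<Rightarrow> nat \<Rightarrow> nat list \<Rightarrow> nat \<Rightarrow> complex mat" where
  "E_mat q12 k r lam i = (let T = tabs k r lam in
     mat (length T) (length T) (\<lambda>(a, b).
       if a = b then alpha q12 (T ! b) i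
       else if T ! a = swap_tab i (T ! b) then beta q12 (T ! b) i else 0))"

definition rho :: "complex \<Rightarrow> nat \<Rightarrow> nat \<Rightarrow> nat list \<Rightarrow> nat \<Rightarrow> complex mat" where
  "rho q12 k r lam i = (let q = q12^2; N = length (tabs k r lam) in
     q \<cdot>\<^sub>m 1\<^sub>m N - (1 + q) \<cdot>\<^sub>m E_mat q12 k r lam i)"

(* A representation of B_n is given by the images of sigma_1..sigma_{n-1}.
   A character of B_n: nonzero scalars psi_i satisfying the braid relations *)
definition braid_character :: "nat \<Rightarrow> (nat \<Rightarrow> complex) \<Rightarrow> bool" where
  "braid_character n psi \<longleftrightarrow> (\<forall>i\<in>{1..<n}. psi i \<noteq> 0) \<and>
     (\<forall>i. 1 \<le> i \<and> i + 1 < n \<longrightarrow> psi i * psi (i+1) * psi i = psi (i+1) * psi i * psi (i+1)) \<and>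
     (\<forall>i j. 1 \<le> i \<and> i < n \<and> 1 \<le> j \<and> j < n \<and> i + 1 < j \<longrightarrow> psi i * psi j = psi j * psi i)"

definition tensor_char :: "(nat \<Rightarrow> complex) \<Rightarrow> (nat \<Rightarrow> complex mat) \<Rightarrow> nat \<Rightarrow> complex mat" where
  "tensor_char psi A i = psi i \<cdot>\<^sub>m A i"

definition contragredient :: "(nat \<Rightarrow> complex mat) \<Rightarrow> nat \<Rightarrow> complex mat" where
  "contragredient A i = transpose_mat (the (mat_inverse (A i)))"

definition rep_equiv :: "nat \<Rightarrow> nat \<Rightarrow> (nat \<Rightarrow> complex mat) \<Rightarrow> nat \<Rightarrow> (nat \<Rightarrow> complex mat) \<Rightarrow> bool" where
  "rep_equiv n N1 A N2 B \<longleftrightarrow> (\<exists>P. P \<in> carrier_mat N1 N2 \<and> invertible_mat P \<and>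
      (\<forall>i\<in>{1..<n}. A i * P = P * B i))"

definition r_conj :: "nat \<Rightarrow> nat \<Rightarrow> nat list \<Rightarrow> nat list" where
  "r_conj k r lam = (let l = r - k in
     rev (dropWhile (\<lambda>x. x = 0) (rev
       (map (\<lambda>j. \<Sum>i\<in>{1..k}. (rowlen lam (i - 1) + l - j) div l) [1..<Suc l]))))"

end

theory Submission
  imports Defs
begin

text \<open>
  The Jucys--Murphy elements, defined by \<open>L\<^sub>0 = 1\<close> and \<open>q L\<^sub>p\<^sub>+\<^sub>1 = \<sigma>\<^sub>p L\<^sub>p \<sigma>\<^sub>p\<close>, act on a basis vector \<open>v\<^sub>t\<close>
  by \<open>q\<close> to the content of the entry \<open>p + 1\<close> of \<open>t\<close>. An intertwiner commutes with them, so each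
  nonzero matrix entry of it relates two tableaux whose contents agree modulo \<open>r\<close>. In an admissible
  diagram the contents of the ends of the rows are distinct modulo \<open>r\<close>, hence such tableaux, and
  therefore their shapes, coincide. The twisting character is trivial because a sector of nontrivial
  type has a non-scalar generator with eigenvalues \<open>q\<close> and \<open>-1\<close>.

  For the contragredient, replacing each entry's row by its column modulo \<open>l = r - k\<close> turns an
  admissible tableau of shape \<open>\<lambda>\<close> into one of the \<open>r\<close>-conjugate shape and negates all contents modulo
  \<open>r\<close>. Up to signs this identifies the sector of the \<open>r\<close>-conjugate with the contragredient twisted by
  \<open>-q\<close>, which reduces the second equivalence to the first.
\<close>

subsection \<open>Admissible words and contents\<close>

text \<open>The coefficient alpha is a rational function of X = q^d alone, where d is the difference
  of the contents of two consecutive entries, and X -> 1/X turns alpha into 1 - alpha. So negating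
  all contents modulo r replaces the diagonal of each E by that of 1 - E and leaves beta as it is.
  On the other side, the quadratic relation gives -q \<sigma>^-1 = (q - 1) - \<sigma>, which is q -
  (1 + q) E with 1 - E in place of E: this is where the twist -q comes from. What remains is the
  sign of beta, absorbed by the parity of the inversions of a tableau word. The two widths are
  independent of each other. Hence a shape has to be recovered from contents without a common width,
  and conversely one diagram seen in two widths has to be shown to carry the same tableaux.\<close>

definition adm_fun :: "nat \<Rightarrow> nat \<Rightarrow> (nat \<Rightarrow> nat) \<Rightarrow> bool" where
  "adm_fun k r f \<longleftrightarrow> (\<forall>j. f (Suc j) \<le> f j) \<and> f k = 0 \<and> f 0 \<le> f (k - 1) + (r - k)"

definition path :: "nat \<Rightarrow> nat \<Rightarrow> nat list \<Rightarrow> bool" where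
  "path k r w \<longleftrightarrow> (\<forall>p\<le>length w. adm_fun k r (\<lambda>j. cnt j (take p w)))"

text \<open>Column minus row of the box of entry \<open>p + 1\<close>, both counted from 0: the
  earlier boxes of the same row are those to its left. Entry \<open>m\<close> sits at position
  \<open>m - 1\<close> of the word, so generators appear below with index
  \<open>Suc p\<close>.\<close>

definition ct :: "nat list \<Rightarrow> nat \<Rightarrow> int" where
  "ct w p = int (cnt (w ! p) (take p w)) - int (w ! p)"

lemma cnt_Nil [simp]: "cnt j [] = 0"
  by (simp add: cnt_def)

lemma cnt_append [simp]: "cnt j (v @ w) = cnt j v + cnt j w"
  by (simp add: cnt_def)

lemma cnt_Cons [simp]: "cnt j (x # w) = (if x = j then 1 else 0) + cnt j w"
  by (simp add: cnt_def)

lemma cnt_eq_0_iff: "cnt j w = 0 \<longleftrightarrow> j \<notin> set w"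
  by (auto simp: cnt_def filter_empty_conv)

lemma cnt_take_le: "cnt j (take p w) \<le> cnt j w"
  by (metis append_take_drop_id cnt_append le_add1)

lemma cnt_take_Suc: "p < length w \<Longrightarrow>
  cnt j (take (Suc p) w) = cnt j (take p w) + (if w ! p = j then 1 else 0)"
  by (simp add: take_Suc_conv_app_nth)

lemma sum_cnt: "set w \<subseteq> {..<m} \<Longrightarrow> (\<Sum>j<m. cnt j w) = length w"
  by (induction w) (auto simp: sum.distrib)

lemma cnt_upt: "cnt j [0..<m] = (if j < m then 1 else 0)"
  by (induction m) auto

lemma antitone_le: "(\<And>j. f (Suc j) \<le> f j) \<Longrightarrow> i \<le> j \<Longrightarrow> f j \<le> (f i :: nat)"
  by (rule lift_Suc_antimono_le)

lemma rowlen_antitone: "young lam \<Longrightarrow> rowlen lam (Suc j) \<le> rowlen lam j"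
  by (auto simp: young_def rowlen_def sorted_wrt_iff_nth_less)

text \<open>Passing from lists to row-length functions makes the counts of a prefix directly usable
  as a diagram. The bound on the number of rows becomes \<open>f k = 0\<close>, and
  \<open>k \<le> r\<close> makes the truncated difference \<open>r - k\<close> in
  \<open>adm_fun\<close> agree with the integer one.\<close>

lemma kr_admissible_iff:
  assumes "young lam" "k \<ge> 1" "k \<le> r"
  shows "kr_admissible k r lam \<longleftrightarrow> adm_fun k r (rowlen lam)"
proof -
  have "length lam \<le> k \<longleftrightarrow> rowlen lam k = 0"
    using assms(1) by (auto simp: young_def rowlen_def)
  then show ?thesis
    using assms rowlen_antitone[OF assms(1)] by (auto simp: kr_admissible_def adm_fun_def)
qed

lemma rowlen_eqI:
  assumes "\<And>j. rowlen u j = rowlen v j" "\<forall>x\<in>set u. 0 < x" "\<forall>x\<in>set v. 0 < x"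
  shows "u = v"
proof -
  have "length u \<le> length v" if "\<And>j. rowlen u j = rowlen v j" "\<forall>x\<in>set u. 0 < x" for u v
  proof (rule ccontr)
    assume a: "\<not> length u \<le> length v"
    then have "0 < u ! length v" using that(2) by simp
    then show False using a that(1)[of "length v"] by (simp add: rowlen_def)
  qed
  from this[of u v] this[of v u] have "length u = length v" using assms by force
  then show ?thesis
    using assms(1) by (intro nth_equalityI) (auto simp: rowlen_def, metis)
qed

text \<open>The positive values of an antitone function come first, so filtering only cuts off a
  tail and no row changes its index.\<close>

lemma filter_pos_antitone:
  assumes "\<And>j. f (Suc j) \<le> (f j :: nat)"
  shows "rowlen (filter (\<lambda>x. 0 < x) (map f [0..<m])) j = (if j < m then f j else 0)"
    and "sorted_wrt (\<ge>) (filter (\<lambda>x. 0 < x) (map f [0..<m]))"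
proof -
  have *: "filter (\<lambda>x. 0 < x) (map f [0..<m]) = map f [0..<card {j. j < m \<and> 0 < f j}]"
  proof (induction m)
    case (Suc m)
    show ?case
    proof (cases "f m = 0")
      case True
      then have "{j. j < Suc m \<and> 0 < f j} = {j. j < m \<and> 0 < f j}"
        by (auto simp: less_Suc_eq)
      then show ?thesis using Suc True by simp
    next
      case False
      have "0 < f j" if "j \<le> m" for j
        using antitone_le[of f, OF assms that] False by simp
      then have "{j. j < m \<and> 0 < f j} = {..<m}" "{j. j < Suc m \<and> 0 < f j} = {..<Suc m}"
        by auto
      then show ?thesis using Suc False by simp
    qed
  qed simp
  have **: "j < card {j. j < m \<and> 0 < f j} \<longleftrightarrow> j < m \<and> 0 < f j" for j
  proof -
    obtain c where c: "{j. j < m \<and> 0 < f j} = {..<c}"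
    proof (cases "\<exists>j<m. f j = 0")
      case True
      define c where "c = (LEAST j. f j = 0)"
      have c0: "f c = 0" unfolding c_def using True by (meson LeastI)
      have c1: "0 < f j" if "j < c" for j using not_less_Least that unfolding c_def by blast
      have "c < m" unfolding c_def using True by (meson Least_le le_less_trans)
      moreover have "f j = 0" if "j \<ge> c" for j using antitone_le[of f, OF assms that] c0 by simp
      ultimately have "{j. j < m \<and> 0 < f j} = {..<c}" using c1
        by (auto) (metis not_le less_irrefl)
      then show ?thesis by (rule that)
    next
      case False
      then show ?thesis by (intro that[of m]) auto
    qed
    then show ?thesis by (metis (mono_tags) card_lessThan lessThan_iff mem_Collect_eq)
  qed
  show "rowlen (filter (\<lambda>x. 0 < x) (map f [0..<m])) j = (if j < m then f j else 0)"
    unfolding * using **[of j] by (auto simp: rowlen_def)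
  show "sorted_wrt (\<ge>) (filter (\<lambda>x. 0 < x) (map f [0..<m]))"
    unfolding * using antitone_le[of f, OF assms] by (auto simp: sorted_wrt_iff_nth_less)
qed

lemma shape_antitone:
  assumes "\<And>j. cnt (Suc j) w \<le> cnt j w"
  shows "rowlen (shape w) j = cnt j w" "young (shape w)"
proof -
  have "cnt j w = 0" if "\<not> j < Suc (Max (insert 0 (set w)))"
  proof -
    have "j \<le> Max (insert 0 (set w))" if "j \<in> set w" using that by (intro Max_ge) auto
    then show ?thesis using that unfolding cnt_eq_0_iff by linarith
  qed
  then show "rowlen (shape w) j = cnt j w"
    unfolding shape_def filter_pos_antitone(1)[of "\<lambda>j. cnt j w", OF assms] by auto
  show "young (shape w)"
    unfolding young_def shape_def
    using filter_pos_antitone(2)[of "\<lambda>j. cnt j w", OF assms] by (auto simp del: upt_Suc)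
qed

text \<open>\<open>shape\<close> drops zero counts wherever they occur and would hide a gap between
  rows, so it is faithful only on words with antitone counts; \<open>standard\<close> supplies this
  for every prefix. The truncations \<open>length w - i\<close> run over all prefixes.\<close>

lemma adm_tableau_iff:
  assumes "k \<ge> 1" "k \<le> r"
  shows "adm_tableau k r w \<longleftrightarrow> path k r w"
proof -
  have "adm_tableau k r w \<longleftrightarrow>
      (\<forall>p\<le>length w. (\<forall>j. cnt (Suc j) (take p w) \<le> cnt j (take p w)) \<and>
         kr_admissible k r (shape (take p w)))"
    unfolding adm_tableau_def standard_def by (metis diff_diff_cancel diff_le_self)
  also have "\<dots> \<longleftrightarrow> path k r w"
  proof -
    have "(\<forall>j. cnt (Suc j) v \<le> cnt j v) \<and> kr_admissible k r (shape v) \<longleftrightarrow>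
        adm_fun k r (\<lambda>j. cnt j v)" for v
    proof (cases "\<forall>j. cnt (Suc j) v \<le> cnt j v")
      case True
      then have "rowlen (shape v) = (\<lambda>j. cnt j v)" "young (shape v)"
        using shape_antitone by auto
      then show ?thesis using True kr_admissible_iff[of "shape v" k r] assms by simp
    qed (auto simp: adm_fun_def)
    then show ?thesis by (simp add: path_def)
  qed
  finally show ?thesis .
qed

lemma path_take: "path k r w \<Longrightarrow> path k r (take p w)"
  by (simp add: path_def min_def)

lemma adm_fun_zero: "adm_fun k r f \<Longrightarrow> k \<le> j \<Longrightarrow> f j = 0"
  using antitone_le[of f k j] by (auto simp: adm_fun_def)

lemma path_adm_fun: "path k r w \<Longrightarrow> adm_fun k r (\<lambda>j. cnt j w)"
  by (metis path_def order_refl take_all)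

lemma path_set: assumes "path k r w" shows "set w \<subseteq> {..<k}"
proof
  fix x assume "x \<in> set w"
  then have "cnt x w \<noteq> 0" by (simp add: cnt_eq_0_iff)
  then show "x \<in> {..<k}"
    using adm_fun_zero[OF path_adm_fun[OF assms], of x] by (meson lessThan_iff not_le)
qed

lemma path_nth: "path k r w \<Longrightarrow> p < length w \<Longrightarrow> w ! p < k"
  using path_set nth_mem by blast

lemma sum_rowlen: "length lam \<le> m \<Longrightarrow> (\<Sum>j<m. rowlen lam j) = sum_list lam"
proof (induction lam arbitrary: m)
  case (Cons x lam)
  then obtain m' where m: "m = Suc m'" by (cases m) auto
  have "(\<Sum>j<m. rowlen (x # lam) j) = x + (\<Sum>j<m'. rowlen lam j)"
    unfolding m sum.lessThan_Suc_shift by (simp add: rowlen_def cong: if_cong)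
  then show ?case using Cons m by simp
qed (simp add: rowlen_def)

lemma has_shape_length: assumes "has_shape w lam" shows "length w = sum_list lam"
proof -
  define m where "m = length lam + Suc (Max (insert 0 (set w)))"
  have "x < m" if "x \<in> set w" for x
  proof -
    have "x \<le> Max (insert 0 (set w))" using that by (intro Max_ge) auto
    then show ?thesis unfolding m_def by linarith
  qed
  then have "set w \<subseteq> {..<m}" by auto
  then have "length w = (\<Sum>j<m. rowlen lam j)"
    using sum_cnt[of w m] assms by (simp add: has_shape_def)
  then show ?thesis using sum_rowlen[of lam m] m_def by simp
qed

lemma set_tabs:
  assumes "k \<ge> 1" "k \<le> r"
  shows "set (tabs k r lam) = {w. path k r w \<and> has_shape w lam}"
  using path_set[of k r] has_shape_length
  by (auto simp: tabs_def adm_tableau_iff[OF assms] set_n_lists lessThan_atLeast0)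

lemma distinct_tabs: "distinct (tabs k r lam)"
  by (simp add: tabs_def distinct_n_lists)

text \<open>For i < j the difference of the two contents is (f i - f j) + (j - i). The first summand
  lies between 0 and r - k, the second between 1 and k - 1, so the sum lies strictly between 0 and
  r.\<close>

lemma contents_distinct:
  assumes "adm_fun k r f" "k \<le> r" "i < k" "j < k"
    "int r dvd (int (f i) - int i) - (int (f j) - int j)"
  shows "i = j"
proof -
  have gen: "False" if "i < j" "j < k"
    "int r dvd (int (f i) - int i) - (int (f j) - int j)" for i j
  proof -
    have "f j \<le> f i" "f i \<le> f 0" "f (k - 1) \<le> f j" "f 0 \<le> f (k - 1) + (r - k)"
      using assms(1) that antitone_le[of f] by (auto simp: adm_fun_def)
    then have "0 < (int (f i) - int i) - (int (f j) - int j)"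
      "(int (f i) - int i) - (int (f j) - int j) < int r"
      using that assms(2) by linarith+
    then show False using that(3) zdvd_not_zless by blast
  qed
  show ?thesis
  proof (rule ccontr)
    assume "i \<noteq> j"
    then consider "i < j" | "j < i" by linarith
    then show False
    proof cases
      case 2
      then show False using gen[of j i] assms(3,5) dvd_diff_commute by blast
    qed (use gen[of i j] assms in blast)
  qed
qed

text \<open>A prefix common to both paths is admissible for \<open>k1\<close> and for \<open>k2\<close>, so the next row can be
  read off from the contents modulo \<open>r\<close> using the larger of the two.\<close>

lemma path_eqI:
  assumes "path k1 r v" "path k2 r w" "k1 \<le> r" "k2 \<le> r" "length v = length w"
    and ct: "\<And>p. p < length w \<Longrightarrow> int r dvd ct v p - ct w p"
  shows "v = w"
proof -
  have "take p v = take p w" if "p \<le> length w" for p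
    using that
  proof (induction p)
    case (Suc p)
    then have t: "take p v = take p w" by simp
    define k where "k = max k1 k2"
    have "adm_fun k r (\<lambda>j. cnt j (take p w))"
      using assms(1,2,5) Suc.prems t unfolding path_def k_def max_def
      by (metis Suc_leD)
    moreover have "v ! p < k" "w ! p < k"
      using path_nth[OF assms(1), of p] path_nth[OF assms(2), of p] Suc.prems assms(5)
      by (auto simp: k_def)
    moreover have "k \<le> r" using assms(3,4) by (simp add: k_def)
    ultimately have "v ! p = w ! p"
      using contents_distinct[of k r "\<lambda>j. cnt j (take p w)" "v ! p" "w ! p"] ct[of p] Suc.prems t
      by (simp add: ct_def)
    then show ?case using t Suc.prems assms(5) by (simp add: take_Suc_conv_app_nth)
  qed simp
  from this[of "length w"] show ?thesis using assms(5) by simp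
qed

text \<open>If the widths differ, the final diagram has fewer rows than the larger one allows, so
  the condition at the larger width bounds the whole first row, in particular by
  \<open>r - k2\<close>. First row and height only shrink on prefixes, so this bound serves all
  along the path.\<close>

lemma path_change_width:
  assumes "path k1 r w" "adm_fun k2 r (\<lambda>j. cnt j w)" "1 \<le> k1" "k1 \<le> r" "1 \<le> k2" "k2 \<le> r"
  shows "path k2 r w"
proof (cases "k1 = k2")
  case False
  let ?f = "\<lambda>j. cnt j w"
  have f1: "adm_fun k1 r ?f" using assms(1) by (rule path_adm_fun)
  have f0: "?f 0 \<le> r - k2"
  proof (cases "k1 < k2")
    case True
    then have "?f (k2 - 1) = 0" using adm_fun_zero[OF f1, of "k2 - 1"] by simp
    then show ?thesis using assms(2) by (simp add: adm_fun_def)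
  next
    case c: False
    then have "?f (k1 - 1) = 0" using adm_fun_zero[OF assms(2), of "k1 - 1"] False by simp
    then show ?thesis using f1 c diff_le_mono2[of k2 k1 r] by (auto simp: adm_fun_def)
  qed
  show ?thesis unfolding path_def
  proof (intro allI impI)
    fix p assume p: "p \<le> length w"
    have a: "adm_fun k1 r (\<lambda>j. cnt j (take p w))" using assms(1) p by (simp add: path_def)
    have "cnt k2 w = 0" using assms(2) by (simp add: adm_fun_def)
    then have "cnt k2 (take p w) = 0" using cnt_take_le[of k2 p w] by simp
    moreover have "cnt 0 (take p w) \<le> r - k2" using f0 cnt_take_le[of 0 p w] by simp
    ultimately show "adm_fun k2 r (\<lambda>j. cnt j (take p w))" using a by (simp add: adm_fun_def)
  qed
qed (use assms in simp)

section \<open>Exchanging two consecutive entries\<close>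

lemma swap_tab_decomp:
  assumes "Suc p < length w"
  obtains u x y v where "w = u @ x # y # v" "length u = p" "swap_tab (Suc p) w = u @ y # x # v"
    "w ! p = x" "w ! Suc p = y"
proof
  let ?v = "drop (Suc (Suc p)) w"
  show w: "w = take p w @ w ! p # w ! Suc p # ?v"
    using assms by (metis Cons_nth_drop_Suc Suc_lessD append_take_drop_id)
  show l: "length (take p w) = p" using assms by simp
  obtain u x y v where *: "u = take p w" "x = w ! p" "y = w ! Suc p" "v = ?v" by blast
  have "swap_tab (Suc p) (u @ x # y # v) = u @ y # x # v"
    using l by (simp add: swap_tab_def list_update_append nth_append flip: *)
  then show "swap_tab (Suc p) w = take p w @ w ! Suc p # w ! p # ?v"
    unfolding * using w by simp
qed auto

lemma length_swap_tab [simp]: "length (swap_tab i w) = length w"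
  by (simp add: swap_tab_def)

lemma swap_tab_swap_tab: "Suc p < length w \<Longrightarrow> swap_tab (Suc p) (swap_tab (Suc p) w) = w"
  by (erule swap_tab_decomp) (auto simp: swap_tab_def list_update_append nth_append)

lemma swap_tab_eq_self_iff: "Suc p < length w \<Longrightarrow> swap_tab (Suc p) w = w \<longleftrightarrow> w ! p = w ! Suc p"
  by (erule swap_tab_decomp) auto

lemma cnt_swap_tab: "Suc p < length w \<Longrightarrow> cnt j (swap_tab (Suc p) w) = cnt j w"
  by (erule swap_tab_decomp) auto

text \<open>As the rows differ, neither entry counts towards the column of the other: both boxes
  stay where they are and only trade their entries.\<close>

lemma ct_swap_tab:
  assumes "Suc p < length w" "w ! p \<noteq> w ! Suc p"
  shows "ct (swap_tab (Suc p) w) p = ct w (Suc p)" "ct (swap_tab (Suc p) w) (Suc p) = ct w p"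
proof -
  obtain u x y v where *: "w = u @ x # y # v" "length u = p"
    "swap_tab (Suc p) w = u @ y # x # v" "w ! p = x" "w ! Suc p = y"
    using swap_tab_decomp[OF assms(1)] .
  then show "ct (swap_tab (Suc p) w) p = ct w (Suc p)" "ct (swap_tab (Suc p) w) (Suc p) = ct w p"
    using assms(2) by (auto simp: ct_def nth_append)
qed

lemma ct_Suc_same: "Suc p < length w \<Longrightarrow> w ! p = w ! Suc p \<Longrightarrow> ct w p - ct w (Suc p) = -1"
  by (simp add: ct_def cnt_take_Suc)

text \<open>This keeps the quantum integer in the denominator of \<open>alpha\<close> away from
  zero. Boxes in different rows can both be measured against the diagram before step
  \<open>p\<close>, where \<open>contents_distinct\<close> applies; boxes in one row have contents
  differing by one.\<close>

lemma ct_Suc_distinct: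
  assumes "path k r w" "Suc p < length w" "2 \<le> r" "k \<le> r"
  shows "\<not> int r dvd ct w p - ct w (Suc p)"
proof (cases "w ! p = w ! Suc p")
  case True
  then show ?thesis using ct_Suc_same[OF assms(2)] assms(3) by auto
next
  case False
  have "adm_fun k r (\<lambda>j. cnt j (take p w))" using assms by (simp add: path_def)
  moreover have "ct w (Suc p) = int (cnt (w ! Suc p) (take p w)) - int (w ! Suc p)"
    using False assms(2) by (simp add: ct_def cnt_take_Suc)
  ultimately show ?thesis
    using contents_distinct[of k r "\<lambda>j. cnt j (take p w)" "w ! p" "w ! Suc p"] False assms
      path_nth[OF assms(1), of p] path_nth[OF assms(1), of "Suc p"]
    by (auto simp: ct_def)
qed

text \<open>The exchange fails only if the second box cannot be added before the first. Either it
  lies directly below the first, or it extends row 0 when this already exceeds row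
  \<open>k - 1\<close> by \<open>r - k\<close>. In the latter case the first box lies in row
  \<open>k - 1\<close>, which acts as a row above row 0 with contents shifted by
  \<open>r\<close>.\<close>

lemma ct_Suc_swap_not_path:
  assumes "path k r w" "Suc p < length w" "2 \<le> k" "k \<le> r"
    and "w ! p \<noteq> w ! Suc p" "\<not> path k r (swap_tab (Suc p) w)"
  shows "int r dvd ct w p - ct w (Suc p) - 1"
proof -
  obtain u x y v where w: "w = u @ x # y # v" "length u = p"
    "swap_tab (Suc p) w = u @ y # x # v" "w ! p = x" "w ! Suc p = y"
    using swap_tab_decomp[OF assms(2)] .
  define f where "f = (\<lambda>j. cnt j u)"
  have a0: "adm_fun k r f"
    using assms(1,2) w unfolding path_def f_def by (drule_tac x = p in spec) simp
  have a2: "adm_fun k r (\<lambda>j. f j + (if x = j then 1 else 0) + (if y = j then 1 else 0))"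
    using assms(1,2) w unfolding path_def f_def
    by (drule_tac x = "Suc (Suc p)" in spec) (simp add: add.assoc)
  \<comment> \<open>The two words differ only in the diagram reached after \<open>Suc p\<close>
    boxes, so this is where admissibility must break.\<close>
  have na: "\<not> adm_fun k r (\<lambda>j. f j + (if y = j then 1 else 0))"
  proof
    assume a1: "adm_fun k r (\<lambda>j. f j + (if y = j then 1 else 0))"
    have "path k r (swap_tab (Suc p) w)" unfolding path_def
    proof (intro allI impI)
      fix m assume m: "m \<le> length (swap_tab (Suc p) w)"
      consider "m \<le> p" | "m = Suc p" | "m \<ge> Suc (Suc p)" by linarith
      then show "adm_fun k r (\<lambda>j. cnt j (take m (swap_tab (Suc p) w)))"
      proof cases
        case 1
        then have "take m (swap_tab (Suc p) w) = take m w" using w by simp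
        then show ?thesis using assms(1) m by (simp add: path_def)
      next
        case 2
        then show ?thesis using a1 w by (simp add: f_def)
      next
        case 3
        then obtain m' where "m = Suc (Suc p) + m'" using le_Suc_ex by blast
        then have "cnt j (take m (swap_tab (Suc p) w)) = cnt j (take m w)" for j
          using w by simp
        then show ?thesis using assms(1) m by (simp add: path_def)
      qed
    qed
    then show False using assms(6) by simp
  qed
  have xy: "x \<noteq> y" "x < k" "y < k"
    using assms(5) w path_nth[OF assms(1), of p] path_nth[OF assms(1), of "Suc p"] assms(2) by auto
  have ct: "ct w p = int (f x) - int x" "ct w (Suc p) = int (f y) - int y"
    using xy w by (auto simp: ct_def f_def nth_append)
  have "f k = 0" "y \<noteq> k" using a0 xy by (auto simp: adm_fun_def)
  then consider j where "f j + (if y = j then 1 else 0) < f (Suc j) + (if y = Suc j then 1 else 0)"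
    | "f 0 + (if y = 0 then 1 else 0) > f (k - 1) + (if y = k - 1 then 1 else 0) + (r - k)"
    using na unfolding adm_fun_def by (auto simp: not_le)
  then show ?thesis
  proof cases
    case 1
    have "f (Suc j) \<le> f j" using a0 by (simp add: adm_fun_def)
    then have y: "y = Suc j" "f (Suc j) = f j" using 1 by (auto split: if_splits)
    have "f (Suc j) + (if x = Suc j then 1 else 0) + (if y = Suc j then 1 else 0)
       \<le> f j + (if x = j then 1 else 0) + (if y = j then 1 else 0)"
      using a2 by (simp add: adm_fun_def)
    then have "x = j" using y xy by (auto split: if_splits)
    then show ?thesis using ct y by simp
  next
    case 2
    have "f 0 \<le> f (k - 1) + (r - k)" using a0 by (simp add: adm_fun_def)
    then have y: "y = 0" "f 0 = f (k - 1) + (r - k)" using 2 assms(3) by (auto split: if_splits)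
    have "f 0 + (if x = 0 then 1 else 0) + (if y = 0 then 1 else 0)
       \<le> f (k - 1) + (if x = k - 1 then 1 else 0) + (if y = k - 1 then 1 else 0) + (r - k)"
      using a2 by (simp add: adm_fun_def)
    then have "x = k - 1" using y xy assms(3) by (auto split: if_splits)
    then have "ct w p - ct w (Suc p) - 1 = - int r" using ct y assms(3,4) by simp
    then show ?thesis by simp
  qed
qed

text \<open>Deleting a removable box may violate the width condition, so the box has to be chosen:
  it is taken from the last row of maximal length. The difference of first and last row then does
  not grow, except when all \<open>k\<close> rows are equal, where it becomes 1, which
  \<open>k < r\<close> allows.\<close>

lemma tabs_nonempty:
  assumes "young lam" "adm_fun k r (rowlen lam)" "2 \<le> k" "k < r"
  shows "tabs k r lam \<noteq> []"
proof -
  have "\<exists>w. path k r w \<and> (\<forall>j. cnt j w = f j)" if "adm_fun k r f" "(\<Sum>j<k. f j) = n" for f n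
    using that
  proof (induction n arbitrary: f)
    case 0
    then have "f j = 0" for j using adm_fun_zero[of k r f j] by (cases "j < k") auto
    then show ?case by (intro exI[of _ "[]"]) (auto simp: path_def adm_fun_def)
  next
    case (Suc n)
    have anti: "f j \<le> f i" if "i \<le> j" for i j
      using antitone_le[of f i j] Suc.prems that by (auto simp: adm_fun_def)
    have f0: "f 0 > 0"
    proof (rule ccontr)
      assume "\<not> ?thesis"
      then have "f j = 0" for j using anti[of 0 j] by simp
      then show False using Suc.prems by simp
    qed
    define i where "i = (LEAST i. f (Suc i) < f 0)"
    have "f (Suc (k - 1)) < f 0" using Suc.prems f0 assms(3) by (simp add: adm_fun_def)
    then have i1: "f (Suc i) < f 0" and ik: "i \<le> k - 1"
      unfolding i_def by (auto intro: LeastI Least_le)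
    have i2: "f j = f 0" if "j \<le> i" for j
    proof (cases j)
      case (Suc j')
      then have "\<not> f (Suc j') < f 0"
        using that not_less_Least[of j' "\<lambda>i. f (Suc i) < f 0"] unfolding i_def by simp
      then show ?thesis using anti[of 0 j] Suc by simp
    qed simp
    define g where "g = f(i := f i - 1)"
    have fg: "f j = g j + (if i = j then 1 else 0)" for j
      using i2[of i] f0 by (auto simp: g_def)
    have g: "adm_fun k r g"
      unfolding adm_fun_def
    proof (intro conjI allI)
      fix j show "g (Suc j) \<le> g j"
        using anti[of j "Suc j"] i1 i2[of i] by (auto simp: g_def)
    next
      show "g k = 0" using Suc.prems ik assms(3) by (auto simp: g_def adm_fun_def)
    next
      show "g 0 \<le> g (k - 1) + (r - k)"
        using Suc.prems i2[of i] i2[of "k - 1"] assms(3,4) by (auto simp: g_def adm_fun_def)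
    qed
    have "(\<Sum>j<k. f j) = (\<Sum>j<k. g j) + 1"
      using ik assms(3) by (simp add: fg sum.distrib)
    then obtain w where w: "path k r w" "\<And>j. cnt j w = g j"
      using Suc.IH[OF g] Suc.prems by auto
    have "path k r (w @ [i])"
      unfolding path_def
    proof (intro allI impI)
      fix p assume "p \<le> length (w @ [i])"
      then consider "p \<le> length w" | "p = Suc (length w)" by fastforce
      then show "adm_fun k r (\<lambda>j. cnt j (take p (w @ [i])))"
      proof cases
        case 2
        have "(\<lambda>j. cnt j (w @ [i])) = f" using w fg by auto
        then show ?thesis using 2 Suc.prems by simp
      qed (use w in \<open>simp add: path_def\<close>)
    qed
    then show ?case using w fg by (intro exI[of _ "w @ [i]"]) auto
  qed
  from this[OF assms(2) refl] obtain w where "path k r w" "has_shape w lam"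
    unfolding has_shape_def by blast
  then have "w \<in> set (tabs k r lam)" using assms by (subst set_tabs) auto
  then show ?thesis by auto
qed

text \<open>If all content differences were 1 or -1 modulo r, the path could not turn. Turning after
  m >= 2 boxes in a row or a column gives the difference m or -m. A row standing alone has at most r
  - k boxes and a column at most k, so m <= r - 2, and neither value is 1 or -1 modulo r. The shape
  would thus be a single row or column.\<close>

lemma exists_generic_step:
  assumes "path k r w" "has_shape w lam" "young lam" "2 \<le> k" "k < r - 1" "\<not> trivial_type k r lam"
  obtains p where "Suc p < length w" "\<not> int r dvd ct w p - ct w (Suc p) - 1"
    "\<not> int r dvd ct w p - ct w (Suc p) + 1"
proof (rule ccontr)
  note witness = that
  assume "\<not> thesis"
  then have d: "int r dvd ct w p - ct w (Suc p) - 1 \<or> int r dvd ct w p - ct w (Suc p) + 1"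
    if "Suc p < length w" for p using witness[OF that] by blast
  have small: "\<not> int r dvd m" if "0 < m" "m < int r" for m
    using that zdvd_not_zless by blast
  have "take m w = replicate m 0 \<or> take m w = [0..<m]" if "m \<le> length w" for m
    using that
  proof (induction m)
    case (Suc m)
    define x where "x = w ! m"
    have tS: "take (Suc m) w = take m w @ [x]" using Suc.prems
      by (simp add: take_Suc_conv_app_nth x_def)
    have a: "adm_fun k r (\<lambda>j. cnt j (take m w))" "adm_fun k r (\<lambda>j. cnt j (take m w @ [x]))"
      using assms(1) Suc.prems tS unfolding path_def by (metis Suc_leD)+
    have b: "cnt (Suc j) (take m w @ [x]) \<le> cnt j (take m w @ [x])" for j
      using a(2) by (simp add: adm_fun_def)
    have c0: "cnt j (replicate m 0) = (if j = 0 then m else 0)" for j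
      by (simp add: cnt_def)
    \<comment> \<open>Words of length at most one count as rows, so the column case may assume
      \<open>m \<ge> 2\<close>.\<close>
    from Suc consider "take m w = replicate m 0" | "m \<ge> 2" "take m w = [0..<m]"
      by (cases "m = 0"; cases "m = 1") auto
    then show ?case
    proof cases
      case 1
      have "x \<le> 1" using b[of "x - 1"] by (cases x) (auto simp: 1 c0 split: if_splits)
      moreover have "False" if "x = 1" "m \<ge> 2"
      proof -
        obtain p where p: "m = Suc p" using \<open>m \<ge> 2\<close> by (cases m) auto
        have "w ! p = 0" using arg_cong[OF 1, of "\<lambda>u. u ! p"] p
          by (simp del: replicate.simps)
        moreover have "take p w = replicate p 0" using arg_cong[OF 1, of "take p"] p
          by (simp del: replicate.simps)
        ultimately have "ct w p = int p" by (simp add: ct_def cnt_def)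
        moreover have "cnt 1 (take m w) = 0" unfolding 1 c0 by simp
        then have "ct w (Suc p) = -1" using that p by (simp add: ct_def x_def)
        ultimately have "int r dvd int p \<or> int r dvd int p + 2"
          using d[of p] Suc.prems p by (simp add: algebra_simps)
        \<comment> \<open>Row \<open>k - 1\<close> is still empty because \<open>k \<ge> 2\<close>,
          so the width condition bounds row 0 itself.\<close>
        moreover have "m \<le> r - k"
          using a(1) assms(4) unfolding adm_fun_def 1 c0 by auto
        then have "0 < int p" "int p + 2 < int r" using p that assms(4,5) by linarith+
        ultimately show False using small[of "int p"] small[of "int p + 2"] by linarith
      qed
      ultimately have "x = 0 \<or> x = 1 \<and> m \<le> 1"
        by (cases "x = 0"; cases "m \<le> 1") auto
      then show ?thesis
      proof (elim disjE)
        assume "x = 0"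
        then show ?thesis using tS 1 by (simp add: replicate_append_same)
      next
        assume x: "x = 1 \<and> m \<le> 1"
        then have "m = 1" using b[of 0] by (cases m) auto
        then show ?thesis using x tS 1 by simp
      qed
    next
      case 2
      have "x = 0 \<or> x = m" using b[of "x - 1"] by (cases x) (auto simp: 2 cnt_upt split: if_splits)
      moreover have "False" if "x = 0"
      proof -
        obtain p where p: "m = Suc p" using \<open>m \<ge> 2\<close> by (cases m) auto
        have "w ! p = p" using arg_cong[OF 2(2), of "\<lambda>u. u ! p"] p
          by (simp del: upt_Suc)
        moreover have "take p w = [0..<p]" using arg_cong[OF 2(2), of "take p"] p by simp
        ultimately have "ct w p = - int p" by (simp add: ct_def cnt_def)
        moreover have "cnt 0 (take m w) = 1" unfolding 2(2) cnt_upt using p by simp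
        then have "ct w (Suc p) = 1" using that p by (simp add: ct_def x_def)
        ultimately have "int r dvd - (int p + 2) \<or> int r dvd - int p"
          using d[of p] Suc.prems p by (simp add: algebra_simps)
        moreover have "m \<le> k"
        proof -
          have "cnt k (take m w) = 0" using a(1) by (simp add: adm_fun_def)
          then show ?thesis unfolding 2(2) cnt_upt by (auto split: if_splits)
        qed
        ultimately have "int r dvd int p \<or> int r dvd int p + 2"
          by (metis dvd_minus_iff)
        moreover have "0 < int p" "int p + 2 < int r"
          using p assms(4,5) 2(1) \<open>m \<le> k\<close> by linarith+
        ultimately show False using small[of "int p"] small[of "int p + 2"] by linarith
      qed
      ultimately show ?thesis using tS 2 by auto
    qed
  qed simp
  from this[of "length w"] have "w = replicate (length w) 0 \<or> w = [0..<length w]" by simp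
  then have "trivial_type k r lam"
  proof
    assume w: "w = replicate (length w) 0"
    have "cnt 1 w = 0" by (subst w) (simp add: cnt_def)
    then have "rowlen lam 1 = 0" using assms(2) by (simp add: has_shape_def)
    moreover have "0 < rowlen lam 1" if "1 < length lam"
      using assms(3) that nth_mem[OF that] by (simp add: rowlen_def young_def)
    ultimately have "length lam \<le> 1" by (cases "1 < length lam") auto
    then show ?thesis by (simp add: trivial_type_def)
  next
    assume w: "w = [0..<length w]"
    have *: "rowlen lam j \<le> 1" for j
    proof -
      have "cnt j w \<le> 1" by (subst w) (simp add: cnt_upt del: upt_Suc)
      then show ?thesis using assms(2) by (simp add: has_shape_def)
    qed
    have "x = 1" if "x \<in> set lam" for x
    proof -
      obtain j where "j < length lam" "x = lam ! j" using \<open>x \<in> set lam\<close> by (metis in_set_conv_nth)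
      then have "x \<le> 1" using *[of j] by (simp add: rowlen_def)
      moreover have "0 < x" using assms(3) that by (simp add: young_def)
      ultimately show ?thesis by linarith
    qed
    then show ?thesis by (simp add: trivial_type_def)
  qed
  then show False using assms(6) by simp
qed

subsection \<open>Conjugation of words\<close>

definition conj_word :: "nat \<Rightarrow> nat list \<Rightarrow> nat list" where
  "conj_word l w = map (\<lambda>p. cnt (w ! p) (take p w) mod l) [0..<length w]"

lemma length_conj_word [simp]: "length (conj_word l w) = length w"
  by (simp add: conj_word_def)

lemma conj_word_nth: "p < length w \<Longrightarrow> conj_word l w ! p = cnt (w ! p) (take p w) mod l"
  by (simp add: conj_word_def)

lemma conj_word_Nil [simp]: "conj_word l [] = []"
  by (simp add: conj_word_def)

lemma conj_word_snoc [simp]: "conj_word l (w @ [x]) = conj_word l w @ [cnt x w mod l]"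
  by (auto simp: conj_word_def nth_append)

lemma take_conj_word: "p \<le> length w \<Longrightarrow> take p (conj_word l w) = conj_word l (take p w)"
  by (auto simp: conj_word_def take_map min_def)

text \<open>For \<open>u < l\<close> the quotient \<open>(c + l - Suc u) div l\<close> is the number
  of columns below \<open>c\<close> congruent to \<open>u\<close> modulo \<open>l\<close>; this is
  its increment.\<close>

lemma conj_row_div_Suc:
  assumes "u < l"
  shows "(Suc c + l - Suc u) div l = (c + l - Suc u) div l + (if c mod l = u then 1 else (0::nat))"
proof -
  have eq: "Suc (c + l - Suc u) = c + (l - u)" "Suc c + l - Suc u = Suc (c + l - Suc u)"
    using assms by auto
  have "l dvd c + (l - u) \<longleftrightarrow> l dvd c mod l + (l - u)"
    by (simp add: dvd_eq_mod_eq_0 mod_add_left_eq)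
  also have "\<dots> \<longleftrightarrow> c mod l = u"
  proof
    have cl: "c mod l < l" using assms by simp
    assume "l dvd c mod l + (l - u)"
    then obtain m where m: "c mod l + (l - u) = l * m" by auto
    have "m \<noteq> 0" using m assms by (intro notI) simp
    moreover have "l * m < l * 2" using m cl by linarith
    then have "m < 2" by simp
    ultimately have "m = 1" by simp
    then show "c mod l = u" using m assms by simp
  qed (use assms in simp)
  finally show ?thesis
    using div_Suc[of "c + l - Suc u" l] unfolding eq(2) unfolding eq(1) dvd_eq_mod_eq_0 by simp
qed

text \<open>Each summand is the tile entry in row \<open>i + 1\<close> and column
  \<open>u + 1\<close> for the diagram of \<open>w\<close>, so the counts of the new word are the
  row sums of the transposed tile. Applied to prefixes, this follows the conjugate diagram box by
  box.\<close>

lemma cnt_conj_word: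
  assumes "set w \<subseteq> {..<k}" "u < l"
  shows "cnt u (conj_word l w) = (\<Sum>i<k. (cnt i w + l - Suc u) div l)"
  using assms(1)
proof (induction w rule: rev_induct)
  case Nil
  show ?case using assms(2) by simp
next
  case (snoc x w)
  have "(cnt i (w @ [x]) + l - Suc u) div l =
     (cnt i w + l - Suc u) div l + (if i = x then if cnt x w mod l = u then 1 else 0 else 0)" for i
    using conj_row_div_Suc[OF assms(2), of "cnt i w"] by auto
  then have "(\<Sum>i<k. (cnt i (w @ [x]) + l - Suc u) div l) =
     (\<Sum>i<k. (cnt i w + l - Suc u) div l) + (if cnt x w mod l = u then 1 else 0)"
    using snoc.prems by (simp add: sum.distrib)
  then show ?case using snoc by simp
qed

lemma cnt_conj_word_ge:
  assumes "0 < l" "l \<le> u"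
  shows "cnt u (conj_word l w) = 0"
proof -
  have "set (conj_word l w) \<subseteq> {..<l}" using assms(1) by (auto simp: conj_word_def)
  then show ?thesis using assms(2) unfolding cnt_eq_0_iff by (meson lessThan_iff not_le subsetD)
qed

text \<open>Between the first and the last column of the tile, rounding changes each row's entry by
  at most one, and there are \<open>k = r - l\<close> rows. This is how number of rows and allowed
  difference trade roles.\<close>

lemma adm_fun_conj:
  assumes "1 \<le> l" "k + l = r" "\<And>u. u < l \<Longrightarrow> g u = (\<Sum>i<k. (f i + l - Suc u) div l)"
    "\<And>u. l \<le> u \<Longrightarrow> g u = 0"
  shows "adm_fun l r g"
  unfolding adm_fun_def
proof (intro conjI allI)
  fix u show "g (Suc u) \<le> g u"
  proof (cases "Suc u < l")
    case True
    then show ?thesis using assms(3) by (auto intro!: sum_mono div_le_mono)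
  qed (simp add: assms(4))
next
  show "g l = 0" using assms(4) by simp
next
  have "(f i + l - Suc 0) div l \<le> f i div l + 1" for i
  proof -
    have "(f i + l - Suc 0) div l \<le> (f i + l) div l" by (rule div_le_mono) simp
    then show ?thesis using assms(1) by simp
  qed
  then have "g 0 \<le> (\<Sum>i<k. f i div l + 1)"
    using assms(1,3) by (auto intro!: sum_mono)
  also have "\<dots> = g (l - 1) + k"
    using assms(1) assms(3)[of "l - 1"] by (simp add: sum_Suc)
  finally show "g 0 \<le> g (l - 1) + (r - l)" using assms(2) by simp
qed

lemma path_conj_word:
  assumes "set w \<subseteq> {..<k}" "1 \<le> l" "k + l = r"
  shows "path l r (conj_word l w)"
  unfolding path_def
proof (intro allI impI)
  fix p assume p: "p \<le> length (conj_word l w)"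
  have s: "set (take p w) \<subseteq> {..<k}" using assms(1) set_take_subset by fastforce
  show "adm_fun l r (\<lambda>j. cnt j (take p (conj_word l w)))"
    using adm_fun_conj[where f = "\<lambda>i. cnt i (take p w)", OF assms(2,3)] cnt_conj_word[OF s]
      cnt_conj_word_ge[of l] assms(2) p by (simp add: take_conj_word)
qed

text \<open>Let the row \<open>x\<close> that receives the box have length \<open>l * s + u\<close>.
  Admissibility before and after the step forces the rows above \<open>x\<close> to be longer than
  \<open>f x\<close> by 1 to \<open>l\<close> boxes and the others to fall short of it by less than
  \<open>l\<close>. Column \<open>u\<close> of the tile thus has entries \<open>s + 1\<close> above
  row \<open>x\<close> and \<open>s\<close> from there on. The new box has row \<open>u\<close> and
  column \<open>k * s + x\<close>, and the two contents add up to \<open>r * s\<close>.\<close>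

lemma ct_conj_word:
  assumes "path k r w" "p < length w" "2 \<le> k" "1 \<le> l" "k + l = r"
  shows "int r dvd ct (conj_word l w) p + ct w p"
proof -
  define f where "f = (\<lambda>i. cnt i (take p w))"
  define x where "x = w ! p"
  define u where "u = f x mod l"
  define s where "s = f x div l"
  have fx: "f x = l * s + u" "u < l" using assms(4) by (auto simp: u_def s_def)
  have xk: "x < k" using path_nth[OF assms(1,2)] by (simp add: x_def)
  have a0: "adm_fun k r f" using assms(1,2) by (simp add: path_def f_def)
  have a1: "adm_fun k r (\<lambda>j. f j + (if x = j then 1 else 0))"
  proof -
    have "(\<lambda>j. f j + (if x = j then 1 else 0)) = (\<lambda>j. cnt j (take (Suc p) w))"
      using assms(2) by (auto simp: f_def x_def cnt_take_Suc)
    then show ?thesis using assms(1,2) by (simp add: path_def)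
  qed
  have anti: "f j \<le> f i" if "i \<le> j" for i j
    using antitone_le[of f i j] a0 that by (auto simp: adm_fun_def)
  have step: "f x + 1 \<le> f x'" if "x = Suc x'" for x'
  proof -
    have "f (Suc x') + (if x = Suc x' then 1 else 0) \<le> f x' + (if x = x' then 1 else 0)"
      using a1 by (simp add: adm_fun_def)
    then show ?thesis using that by simp
  qed
  have f0: "f 0 \<le> f (k - 1) + l" using a0 assms(5) by (auto simp: adm_fun_def)
  have row_term: "(f i + l - Suc u) div l = s + (if i < x then 1 else 0)" if "i < k" for i
  proof (cases "i < x")
    case True
    have "f x + 1 \<le> f (x - 1)" using step[of "x - 1"] True by simp
    then have y: "f x + 1 \<le> f i" "f i \<le> f x + l"
      using anti[of i "x - 1"] anti[of 0 i] anti[of x "k - 1"] f0 True xk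
      by linarith+
    then have "f i + l - Suc u = l * (s + 1) + (f i - f x - 1)" using fx by simp
    moreover have "f i - f x - 1 < l" using y assms(4) by simp
    ultimately show ?thesis using True assms(4) by (simp add: div_mult_self4 del: mult_Suc_right)
  next
    case False
    \<comment> \<open>For row 0 this is the width condition after the box has been added; for a
      lower row it follows because row \<open>x - 1\<close> is strictly longer.\<close>
    have "f x + 1 \<le> f (k - 1) + l"
    proof (cases x)
      case 0
      then show ?thesis using a1 assms(3,5) by (auto simp: adm_fun_def split: if_splits)
    next
      case (Suc x')
      have "f x + 1 \<le> f x'" using step[of x'] Suc by simp
      then show ?thesis using anti[of 0 x'] f0 by simp
    qed
    then have y: "f x + 1 \<le> f i + l" "f i \<le> f x"
      using anti[of i "k - 1"] anti[of x i] False that by linarith+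
    then have "f i + l - Suc u = l * s + (f i + l - 1 - f x)" using fx by simp
    moreover have "f i + l - 1 - f x < l" using y assms(4) by simp
    ultimately show ?thesis using False assms(4) by (simp add: div_mult_self4)
  qed
  have s1: "set (take p w) \<subseteq> {..<k}" using path_set[OF assms(1)] set_take_subset by fastforce
  have "{i. i < k \<and> i < x} = {..<x}" using xk by auto
  then have "(\<Sum>i<k. if i < x then 1 else 0 :: nat) = x"
    by (simp add: sum.If_cases Int_def)
  then have "(\<Sum>i<k. (f i + l - Suc u) div l) = k * s + x"
    using row_term by (simp add: sum.distrib)
  then have "cnt u (take p (conj_word l w)) = k * s + x"
    using cnt_conj_word[OF s1 fx(2)] assms(2) by (simp add: take_conj_word f_def)
  moreover have "conj_word l w ! p = u"
    using assms(2) by (simp add: conj_word_nth u_def f_def x_def)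
  ultimately have "ct (conj_word l w) p = int k * int s + int x - int u" by (simp add: ct_def)
  moreover have "ct w p = int l * int s + int u - int x"
    using fx(1) by (simp add: ct_def f_def x_def flip: of_nat_mult of_nat_add)
  ultimately have "ct (conj_word l w) p + ct w p = int r * int s"
    using assms(5) by (auto simp: algebra_simps)
  then show ?thesis by simp
qed

text \<open>Two conjugations negate the contents modulo \<open>r\<close> twice, and a path is
  determined by its contents modulo \<open>r\<close>. This spares an inversion of the column
  formula.\<close>

lemma conj_word_conj_word:
  assumes "path k r w" "2 \<le> k" "2 \<le> l" "k + l = r"
  shows "conj_word k (conj_word l w) = w"
proof -
  have c: "path l r (conj_word l w)"
    using path_conj_word[OF path_set[OF assms(1)]] assms by simp
  have cc: "path k r (conj_word k (conj_word l w))"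
    using path_conj_word[OF path_set[OF c], of k r] assms by simp
  show ?thesis
  proof (rule path_eqI[OF cc assms(1)])
    fix p assume p: "p < length w"
    have "int r dvd ct (conj_word k (conj_word l w)) p + ct (conj_word l w) p"
      using ct_conj_word[OF c, of p k] p assms by simp
    moreover have "int r dvd ct (conj_word l w) p + ct w p"
      using ct_conj_word[OF assms(1) p, of l] assms by simp
    ultimately have "int r dvd (ct (conj_word k (conj_word l w)) p + ct (conj_word l w) p)
       - (ct (conj_word l w) p + ct w p)" by (rule dvd_diff)
    then show "int r dvd ct (conj_word k (conj_word l w)) p - ct w p"
      by (simp add: algebra_simps)
  qed (use assms in simp_all)
qed

text \<open>With different rows the columns of the two boxes do not change, and the columns of later
  boxes depend only on counts, which do not see the order of the two letters.\<close>

lemma conj_word_swap_tab: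
  assumes "Suc p < length w" "w ! p \<noteq> w ! Suc p"
  shows "conj_word l (swap_tab (Suc p) w) = swap_tab (Suc p) (conj_word l w)"
  using assms
proof (induction w rule: rev_induct)
  case (snoc z w)
  have sw: "swap_tab (Suc p) (v @ [y]) = swap_tab (Suc p) v @ [y]" if "Suc p < length v" for v y
    using that by (auto simp: swap_tab_def list_update_append nth_append)
  show ?case
  proof (cases "Suc p < length w")
    case True
    then show ?thesis using snoc by (simp add: sw cnt_swap_tab nth_append)
  next
    case False
    then have p: "Suc p = length w" using snoc.prems by simp
    then obtain u x where w: "w = u @ [x]" by (metis length_0_conv nat.distinct(1) rev_exhaust)
    then have u: "length u = p" using p by simp
    have "conj_word l (u @ [x, z]) = conj_word l u @ [cnt x u mod l, cnt z u mod l]"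
      and "conj_word l (u @ [z, x]) = conj_word l u @ [cnt z u mod l, cnt x u mod l]"
      using conj_word_snoc[of l "u @ [x]" z] conj_word_snoc[of l "u @ [z]" x] snoc.prems w u
      by (auto simp: nth_append)
    then show ?thesis
      using w u by (auto simp: swap_tab_def list_update_append nth_append)
  qed
qed simp

text \<open>The parity of the number of inversions. Conjugating by the diagonal matrix of these
  signs negates the off-diagonal entries of every generator, since they link words that differ by
  one exchange.\<close>

fun word_sign :: "nat list \<Rightarrow> complex" where
  "word_sign [] = 1"
| "word_sign (x # w) = (-1) ^ length (filter (\<lambda>y. y < x) w) * word_sign w"

lemma word_sign_sq: "word_sign w * word_sign w = 1"
  by (induction w) (simp_all add: mult.assoc mult.left_commute flip: power_add mult_2)

lemma word_sign_swap_tab: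
  assumes "Suc p < length w" "w ! p \<noteq> w ! Suc p"
  shows "word_sign (swap_tab (Suc p) w) = - word_sign w"
proof -
  have sw: "word_sign (u @ y # x # v) = - word_sign (u @ x # y # v)" if "x \<noteq> y" for u v x y
    using that by (induction u) (auto simp: not_less_iff_gr_or_eq)
  obtain u x y v where w: "w = u @ x # y # v" "swap_tab (Suc p) w = u @ y # x # v"
    "w ! p = x" "w ! Suc p = y"
    by (rule swap_tab_decomp[OF assms(1)])
  show ?thesis using sw[of x y u v] assms(2) unfolding w(2-4) unfolding w(1) by blast
qed

section \<open>The r-conjugate diagram\<close>

lemma rowlen_strip: "rowlen (rev (dropWhile (\<lambda>x. x = 0) (rev xs))) j = rowlen xs j"
  by (induction xs rule: rev_induct) (auto simp: rowlen_def nth_append)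

lemma last_strip:
  "rev (dropWhile (\<lambda>x. x = 0) (rev xs)) \<noteq> [] \<Longrightarrow> last (rev (dropWhile (\<lambda>x. x = (0::nat)) (rev xs))) \<noteq> 0"
  by (induction xs rule: rev_induct) auto

lemma rowlen_r_conj:
  "rowlen (r_conj k r lam) j =
    (if j < r - k then \<Sum>i<k. (rowlen lam i + (r - k) - Suc j) div (r - k) else 0)"
proof -
  have "{1..k} = Suc ` {..<k}" by (simp add: image_Suc_lessThan)
  then have "(\<Sum>i\<in>{1..k}. (rowlen lam (i - 1) + l - j) div l) = (\<Sum>i<k. (rowlen lam i + l - j) div l)" for l j
    by (simp add: sum.reindex)
  then show ?thesis
    unfolding r_conj_def Let_def rowlen_strip by (simp add: rowlen_def del: upt_Suc)
qed

lemma adm_fun_r_conj: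
  assumes "1 \<le> k" "k < r"
  shows "adm_fun (r - k) r (rowlen (r_conj k r lam))"
  by (rule adm_fun_conj[of _ k _ _ "rowlen lam"]) (use assms in \<open>auto simp: rowlen_r_conj\<close>)

text \<open>After stripping zeros the last row is nonzero, and antitone row lengths then make all
  earlier rows positive.\<close>

lemma young_r_conj:
  assumes "1 \<le> k" "k < r"
  shows "young (r_conj k r lam)"
proof -
  let ?c = "r_conj k r lam"
  have anti: "rowlen ?c j \<le> rowlen ?c i" if "i \<le> j" for i j
    using antitone_le[of "rowlen ?c" i j] adm_fun_r_conj[OF assms, of lam] that by (auto simp: adm_fun_def)
  have pos: "0 < ?c ! i" if "i < length ?c" for i
  proof -
    have "?c \<noteq> []" using that by auto
    then have "last ?c \<noteq> 0" unfolding r_conj_def Let_def by (rule last_strip)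
    then have "rowlen ?c (length ?c - 1) > 0" using \<open>?c \<noteq> []\<close> by (simp add: rowlen_def last_conv_nth)
    then have "rowlen ?c i > 0" using anti[of i "length ?c - 1"] that by linarith
    then show ?thesis using that by (simp add: rowlen_def)
  qed
  have "?c ! j \<le> ?c ! i" if "i < j" "j < length ?c" for i j
    using anti[of i j] that by (simp add: rowlen_def)
  then show ?thesis using pos by (auto simp: young_def sorted_wrt_iff_nth_less in_set_conv_nth)
qed

lemma has_shape_conj_word:
  assumes "path k r w" "has_shape w lam" "k < r"
  shows "has_shape (conj_word (r - k) w) (r_conj k r lam)"
  unfolding has_shape_def rowlen_r_conj
  using cnt_conj_word[OF path_set[OF assms(1)], of _ "r - k"] cnt_conj_word_ge[of "r - k"] assms(2,3)
  by (auto simp: has_shape_def)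

text \<open>The involution on diagrams is read off from the one on words: some tableau of shape
  \<open>lam\<close> exists, it returns to itself, and its counts determine both shapes.\<close>

lemma r_conj_r_conj:
  assumes "young lam" "adm_fun k r (rowlen lam)" "2 \<le> k" "k < r - 1"
  shows "r_conj (r - k) r (r_conj k r lam) = lam"
proof -
  have "tabs k r lam \<noteq> []" using tabs_nonempty[of lam k r] assms by simp
  then obtain w where "w \<in> set (tabs k r lam)" using hd_in_set by blast
  then have w: "path k r w" "has_shape w lam" using assms by (auto simp: set_tabs)
  have c: "path (r - k) r (conj_word (r - k) w)"
    using path_conj_word[OF path_set[OF w(1)]] assms by simp
  have "has_shape (conj_word (r - (r - k)) (conj_word (r - k) w)) (r_conj (r - k) r (r_conj k r lam))"
    using has_shape_conj_word[OF c has_shape_conj_word[OF w]] assms by simp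
  then have "has_shape w (r_conj (r - k) r (r_conj k r lam))"
    using conj_word_conj_word[OF w(1), of "r - k"] assms by simp
  then show ?thesis
    using w(2) young_r_conj[of "r - k" r] assms
    by (intro rowlen_eqI) (auto simp: has_shape_def young_def)
qed

lemma bij_betw_conj_word:
  assumes "young lam" "adm_fun k r (rowlen lam)" "2 \<le> k" "k < r - 1"
  shows "bij_betw (conj_word (r - k)) (set (tabs k r lam)) (set (tabs (r - k) r (r_conj k r lam)))"
proof -
  \<comment> \<open>Stated for arbitrary width and shape, because it serves for \<open>k\<close> and
    \<open>lam\<close> as well as for \<open>r - k\<close> and the conjugate shape.\<close>
  have fwd: "conj_word (r - k) w \<in> set (tabs (r - k) r (r_conj k r lam))"
      "conj_word k (conj_word (r - k) w) = w"
    if "w \<in> set (tabs k r lam)" "2 \<le> k" "k < r - 1" for w k lam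
  proof -
    from that have w: "path k r w" "has_shape w lam" by (auto simp: set_tabs)
    show "conj_word k (conj_word (r - k) w) = w"
      using conj_word_conj_word[OF w(1), of "r - k"] that by simp
    show "conj_word (r - k) w \<in> set (tabs (r - k) r (r_conj k r lam))"
      using path_conj_word[OF path_set[OF w(1)], of "r - k" r] has_shape_conj_word[OF w] that
      by (auto simp: set_tabs)
  qed
  have rk: "r - (r - k) = k" "2 \<le> r - k" "r - k < r - 1" using assms by auto
  show ?thesis
  proof (rule bij_betw_byWitness[where f' = "conj_word k"])
    show "conj_word k ` set (tabs (r - k) r (r_conj k r lam)) \<subseteq> set (tabs k r lam)"
      using fwd(1)[OF _ rk(2,3), of _ "r_conj k r lam"] unfolding r_conj_r_conj[OF assms] rk(1)
      by (rule image_subsetI)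
    show "\<forall>w\<in>set (tabs (r - k) r (r_conj k r lam)). conj_word (r - k) (conj_word k w) = w"
      using fwd(2)[OF _ rk(2,3), of _ "r_conj k r lam"] unfolding rk(1) by (rule ballI)
    show "\<forall>w\<in>set (tabs k r lam). conj_word k (conj_word (r - k) w) = w"
      using fwd(2)[OF _ assms(3,4), of _ lam] by (rule ballI)
    show "conj_word (r - k) ` set (tabs k r lam) \<subseteq> set (tabs (r - k) r (r_conj k r lam))"
      using fwd(1)[OF _ assms(3,4), of _ lam] by (rule image_subsetI)
  qed
qed

subsection \<open>Matrices indexed by tableaux and twisted equivalence\<close>

text \<open>Coefficients as functions of tableaux rather than of list positions: products become
  sums over \<open>set T\<close>, where exchanges can be followed.\<close>

definition fmat :: "nat list list \<Rightarrow> (nat list \<Rightarrow> nat list \<Rightarrow> complex) \<Rightarrow> complex mat" where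
  "fmat T F = mat (length T) (length T) (\<lambda>(a, b). F (T ! a) (T ! b))"

lemma fmat_carrier [simp]: "fmat T F \<in> carrier_mat (length T) (length T)"
  by (simp add: fmat_def)

lemma fmat_cong:
  "(\<And>s t. s \<in> set T \<Longrightarrow> t \<in> set T \<Longrightarrow> F s t = G s t) \<Longrightarrow> fmat T F = fmat T G"
  by (auto simp: fmat_def intro!: eq_matI)

lemma sum_nth_set:
  "distinct T \<Longrightarrow> (\<Sum>c<length T. f (T ! c)) = sum f (set T)"
  using sum.reindex_bij_betw[OF bij_betw_nth[of T "{..<length T}" "set T"]] by simp

lemma fmat_mult:
  assumes "distinct T"
  shows "fmat T F * fmat T G = fmat T (\<lambda>s u. \<Sum>t\<in>set T. F s t * G t u)"
  using sum_nth_set[OF assms]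
  by (intro eq_matI) (auto simp: fmat_def scalar_prod_def lessThan_atLeast0)

lemma fmat_one: "distinct T \<Longrightarrow> fmat T (\<lambda>s t. if s = t then 1 else 0) = 1\<^sub>m (length T)"
  by (intro eq_matI) (auto simp: fmat_def nth_eq_iff_index_eq)

lemma smult_smult_mat: "a \<cdot>\<^sub>m (b \<cdot>\<^sub>m A) = (a * b) \<cdot>\<^sub>m (A :: 'a :: semigroup_mult mat)"
  by (auto intro!: eq_matI simp: mult.assoc)

lemma one_smult_mat: "1 \<cdot>\<^sub>m A = (A :: 'a :: monoid_mult mat)"
  by (auto intro!: eq_matI)

lemma smult_add_one_mult:
  fixes A P :: "complex mat"
  assumes "A \<in> carrier_mat n n" "P \<in> carrier_mat n n"
  shows "(a \<cdot>\<^sub>m A + b \<cdot>\<^sub>m 1\<^sub>m n) * P = a \<cdot>\<^sub>m (A * P) + b \<cdot>\<^sub>m P"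
    and "P * (a \<cdot>\<^sub>m A + b \<cdot>\<^sub>m 1\<^sub>m n) = a \<cdot>\<^sub>m (P * A) + b \<cdot>\<^sub>m P"
proof -
  have "(a \<cdot>\<^sub>m A + b \<cdot>\<^sub>m 1\<^sub>m n) * P = (a \<cdot>\<^sub>m A) * P + (b \<cdot>\<^sub>m 1\<^sub>m n) * P"
    using assms by (intro add_mult_distrib_mat) auto
  then show "(a \<cdot>\<^sub>m A + b \<cdot>\<^sub>m 1\<^sub>m n) * P = a \<cdot>\<^sub>m (A * P) + b \<cdot>\<^sub>m P"
    using assms by (simp add: mult_smult_assoc_mat[of _ n n _ n])
  have "P * (a \<cdot>\<^sub>m A + b \<cdot>\<^sub>m 1\<^sub>m n) = P * (a \<cdot>\<^sub>m A) + P * (b \<cdot>\<^sub>m 1\<^sub>m n)"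
    using assms by (intro mult_add_distrib_mat) auto
  then show "P * (a \<cdot>\<^sub>m A + b \<cdot>\<^sub>m 1\<^sub>m n) = a \<cdot>\<^sub>m (P * A) + b \<cdot>\<^sub>m P"
    using assms by (simp add: mult_smult_distrib[of _ n n _ n])
qed

lemma mat_inverse_eqI:
  fixes A :: "'a :: field mat"
  assumes "A \<in> carrier_mat n n" "B \<in> carrier_mat n n" "A * B = 1\<^sub>m n" "B * A = 1\<^sub>m n"
  shows "mat_inverse A = Some B"
proof (cases "mat_inverse A")
  case None
  then have "A \<notin> Units (ring_mat TYPE('a) n ())" by (rule mat_inverse(1)[OF assms(1)])
  then show ?thesis using assms by (auto simp: Units_def ring_mat_def)
next
  case (Some C)
  then have C: "C * A = 1\<^sub>m n" "C \<in> carrier_mat n n"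
    using mat_inverse(2)[OF assms(1)] by auto
  have "C = C * (A * B)" using assms C by simp
  also have "\<dots> = (C * A) * B" using assms C by (intro assoc_mult_mat[symmetric]) auto
  also have "\<dots> = B" using assms C by simp
  finally show ?thesis using Some by simp
qed

section \<open>Equivalence of representations up to a character\<close>

lemma rep_equivE:
  assumes "rep_equiv n N1 A N2 B"
  obtains P P' where "N1 = N2" "P \<in> carrier_mat N2 N2" "P' \<in> carrier_mat N2 N2"
    "P * P' = 1\<^sub>m N2" "P' * P = 1\<^sub>m N2" "\<And>i. i \<in> {1..<n} \<Longrightarrow> A i * P = P * B i"
proof -
  obtain P where P: "P \<in> carrier_mat N1 N2" "invertible_mat P"
    "\<And>i. i \<in> {1..<n} \<Longrightarrow> A i * P = P * B i"
    using assms unfolding rep_equiv_def by blast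
  have N: "N1 = N2" using P by (auto simp: invertible_mat_def)
  obtain P' where P': "P * P' = 1\<^sub>m (dim_row P)" "P' * P = 1\<^sub>m (dim_row P')"
    using P(2) by (auto simp: invertible_mat_def inverts_mat_def)
  have "dim_col (P * P') = N2" "dim_col (P' * P) = dim_row P'"
    using P' P N by auto
  then have "P' \<in> carrier_mat N2 N2" using P N by auto
  then show ?thesis using that[of P P'] P P' N by auto
qed

lemma rep_equivI:
  assumes "P \<in> carrier_mat N N" "P' \<in> carrier_mat N N" "P * P' = 1\<^sub>m N" "P' * P = 1\<^sub>m N"
    "\<And>i. i \<in> {1..<n} \<Longrightarrow> A i * P = P * B i"
  shows "rep_equiv n N A N B"
proof -
  have "invertible_mat P"
    using assms(1-4) unfolding invertible_mat_def inverts_mat_def by auto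
  then show ?thesis using assms unfolding rep_equiv_def by auto
qed

lemma rep_equiv_twist_trans:
  assumes "rep_equiv n N1 A N2 (tensor_char psi B)" "rep_equiv n N2 B N3 (tensor_char phi C)"
    and cA: "\<And>i. i \<in> {1..<n} \<Longrightarrow> A i \<in> carrier_mat N1 N1"
    and cB: "\<And>i. i \<in> {1..<n} \<Longrightarrow> B i \<in> carrier_mat N2 N2"
    and cC: "\<And>i. i \<in> {1..<n} \<Longrightarrow> C i \<in> carrier_mat N3 N3"
  shows "rep_equiv n N1 A N3 (tensor_char (\<lambda>i. psi i * phi i) C)"
proof -
  obtain P P' where P: "N1 = N2" "P \<in> carrier_mat N2 N2" "P' \<in> carrier_mat N2 N2"
    "P * P' = 1\<^sub>m N2" "P' * P = 1\<^sub>m N2"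
    "\<And>i. i \<in> {1..<n} \<Longrightarrow> A i * P = P * tensor_char psi B i"
    using rep_equivE[OF assms(1)] by metis
  obtain R R' where R: "N2 = N3" "R \<in> carrier_mat N3 N3" "R' \<in> carrier_mat N3 N3"
    "R * R' = 1\<^sub>m N3" "R' * R = 1\<^sub>m N3"
    "\<And>i. i \<in> {1..<n} \<Longrightarrow> B i * R = R * tensor_char phi C i"
    using rep_equivE[OF assms(2)] by metis
  define N where "N = N3"
  have N: "N1 = N" "N2 = N" "N3 = N" using P(1) R(1) by (auto simp: N_def)
  note P = P[unfolded N] note R = R[unfolded N]
  have "rep_equiv n N A N (tensor_char (\<lambda>i. psi i * phi i) C)"
  proof (rule rep_equivI)
    show "P * R \<in> carrier_mat N N" "R' * P' \<in> carrier_mat N N" using P R by auto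
    have "P * R * (R' * P') = P * (R * R') * P'"
      using P(2,3) R(2,3) by (simp add: assoc_mult_mat[of _ N N _ N _ N])
    then show "P * R * (R' * P') = 1\<^sub>m N" using P R by simp
    have "R' * P' * (P * R) = R' * (P' * P) * R"
      using P(2,3) R(2,3) by (simp add: assoc_mult_mat[of _ N N _ N _ N])
    then show "R' * P' * (P * R) = 1\<^sub>m N" using P R by simp
    fix i assume i: "i \<in> {1..<n}"
    note c = cA[OF i, unfolded N] cB[OF i, unfolded N] cC[OF i, unfolded N]
    have "A i * (P * R) = A i * P * R"
      using P(2,3) R(2,3) c by (simp add: assoc_mult_mat[of _ N N _ N _ N])
    also have "\<dots> = P * (psi i \<cdot>\<^sub>m B i) * R" using P(6)[OF i] by (simp add: tensor_char_def)
    also have "\<dots> = psi i \<cdot>\<^sub>m (P * B i * R)"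
      using P R c by (simp add: mult_smult_distrib[of _ N N _ N] mult_smult_assoc_mat[of _ N N _ N])
    also have "P * B i * R = P * (B i * R)"
      using P(2,3) R(2,3) c by (simp add: assoc_mult_mat[of _ N N _ N _ N])
    also have "\<dots> = P * (R * (phi i \<cdot>\<^sub>m C i))" using R(6)[OF i] by (simp add: tensor_char_def)
    also have "\<dots> = phi i \<cdot>\<^sub>m (P * R * C i)"
      using P R c by (simp add: mult_smult_distrib[of _ N N _ N] assoc_mult_mat[of _ N N _ N _ N])
    also have "psi i \<cdot>\<^sub>m \<dots> = P * R * tensor_char (\<lambda>i. psi i * phi i) C i"
      using P R c by (simp add: tensor_char_def mult_smult_distrib[of _ N N _ N] smult_smult_mat)
    finally show "A i * (P * R) = P * R * tensor_char (\<lambda>i. psi i * phi i) C i" .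
  qed
  then show ?thesis by (simp add: N)
qed

lemma rep_equiv_twist_sym:
  assumes "rep_equiv n N1 A N2 (tensor_char psi B)"
    and cA: "\<And>i. i \<in> {1..<n} \<Longrightarrow> A i \<in> carrier_mat N1 N1"
    and cB: "\<And>i. i \<in> {1..<n} \<Longrightarrow> B i \<in> carrier_mat N2 N2"
    and nz: "\<And>i. i \<in> {1..<n} \<Longrightarrow> psi i \<noteq> 0"
  shows "rep_equiv n N2 B N1 (tensor_char (\<lambda>i. 1 / psi i) A)"
proof -
  obtain P P' where P: "N1 = N2" "P \<in> carrier_mat N2 N2" "P' \<in> carrier_mat N2 N2"
    "P * P' = 1\<^sub>m N2" "P' * P = 1\<^sub>m N2"
    "\<And>i. i \<in> {1..<n} \<Longrightarrow> A i * P = P * tensor_char psi B i"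
    using rep_equivE[OF assms(1)] by metis
  let ?N = N2
  have "rep_equiv n ?N B ?N (tensor_char (\<lambda>i. 1 / psi i) A)"
  proof (rule rep_equivI)
    fix i assume i: "i \<in> {1..<n}"
    note c = cA[OF i, unfolded P(1)] cB[OF i]
    have c': "A i * P \<in> carrier_mat ?N ?N" "psi i \<cdot>\<^sub>m B i \<in> carrier_mat ?N ?N"
      using mult_carrier_mat[OF c(1) P(2)] c(2) by auto
    have "P' * (A i * P) * P' = P' * (P * (psi i \<cdot>\<^sub>m B i)) * P'"
      using P(6)[OF i] by (simp add: tensor_char_def)
    moreover have "P' * (A i * P) * P' = P' * A i * (P * P')"
      using P(2,3) c c' by (simp add: assoc_mult_mat[of _ ?N ?N _ ?N _ ?N])
    moreover have "P' * (P * (psi i \<cdot>\<^sub>m B i)) * P' = (P' * P) * (psi i \<cdot>\<^sub>m B i) * P'"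
      using P(2,3) c c' by (simp add: assoc_mult_mat[of _ ?N ?N _ ?N _ ?N])
    ultimately have "P' * A i = psi i \<cdot>\<^sub>m (B i * P')"
      using P(3-5) c mult_smult_assoc_mat[OF c(2) P(3)] left_mult_one_mat[OF c'(2)]
        right_mult_one_mat[OF mult_carrier_mat[OF P(3) c(1)]] by simp
    then have "(1 / psi i) \<cdot>\<^sub>m (P' * A i) = B i * P'"
      using nz[OF i] by (simp add: smult_smult_mat one_smult_mat)
    then show "B i * P' = P' * tensor_char (\<lambda>i. 1 / psi i) A i"
      using P c by (simp add: tensor_char_def mult_smult_distrib[of _ ?N ?N _ ?N])
  qed (use P in auto)
  then show ?thesis by (simp add: P(1))
qed

text \<open>The intertwiner is a signed permutation matrix, inverted by its transpose because each
  \<open>e t\<close> squares to one. A change of width uses the constant sign 1, conjugation uses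
  \<open>word_sign\<close>.\<close>

lemma rep_equiv_fmat:
  assumes d: "distinct T1" "distinct T2" and f: "bij_betw f (set T2) (set T1)"
    and A: "\<And>i. i \<in> {1..<n} \<Longrightarrow> A i = fmat T1 (F i)"
    and B: "\<And>i. i \<in> {1..<n} \<Longrightarrow> B i = fmat T2 (G i)"
    and e: "\<And>t. e t * e t = (1::complex)"
    and FG: "\<And>i s t. i \<in> {1..<n} \<Longrightarrow> s \<in> set T2 \<Longrightarrow> t \<in> set T2 \<Longrightarrow>
      F i (f s) (f t) * e t = e s * G i s t"
  shows "rep_equiv n (length T1) A (length T2) B"
proof -
  have N: "length T1 = length T2"
    using bij_betw_same_card[OF f] d by (simp add: distinct_card)
  define P where "P = mat (length T2) (length T2) (\<lambda>(a, b). if T1 ! a = f (T2 ! b) then e (T2 ! b) else 0)"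
  define P' where "P' = mat (length T2) (length T2) (\<lambda>(a, b). if T1 ! b = f (T2 ! a) then e (T2 ! a) else 0)"
  have inj: "f s = f t \<longleftrightarrow> s = t" if "s \<in> set T2" "t \<in> set T2" for s t
    using f that by (auto simp: bij_betw_def inj_on_def)
  have mem: "f t \<in> set T1" if "t \<in> set T2" for t using f that by (auto simp: bij_betw_def)
  have s1: "(\<Sum>c = 0..<length T2. h (T1 ! c)) = (\<Sum>t\<in>set T2. h (f t))" for h :: "nat list \<Rightarrow> complex"
    using sum_nth_set[OF d(1), of h] sum.reindex_bij_betw[OF f, of h] N
    by (simp add: lessThan_atLeast0)
  have s2: "(\<Sum>c = 0..<length T2. h (T2 ! c)) = (\<Sum>t\<in>set T2. h t)" for h :: "nat list \<Rightarrow> complex"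
    using sum_nth_set[OF d(2), of h] by (simp add: lessThan_atLeast0)
  have pre: "\<exists>s\<in>set T2. T1 ! a = f s" if "a < length T2" for a
    using f that N nth_mem[of a T1] by (metis bij_betw_def imageE)
  have "rep_equiv n (length T2) A (length T2) B"
  proof (rule rep_equivI)
    show "P \<in> carrier_mat (length T2) (length T2)" "P' \<in> carrier_mat (length T2) (length T2)"
      by (auto simp: P_def P'_def)
    show "P * P' = 1\<^sub>m (length T2)"
    proof (rule eq_matI)
      fix a b assume "a < dim_row (1\<^sub>m (length T2))" "b < dim_col (1\<^sub>m (length T2))"
      then have ab: "a < length T2" "b < length T2" by auto
      obtain s t where st: "s \<in> set T2" "t \<in> set T2" "T1 ! a = f s" "T1 ! b = f t"
        using pre ab by blast
      have "(P * P') $$ (a, b) = (\<Sum>u\<in>set T2. (if f s = f u then e u else 0) * (if f t = f u then e u else 0))"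
        using ab st by (simp add: P_def P'_def scalar_prod_def flip: s2)
      also have "\<dots> = (\<Sum>u\<in>set T2. if u = s then (if s = t then 1 else 0) else 0)"
        using st by (intro sum.cong) (auto simp: inj e)
      also have "\<dots> = (if s = t then 1 else 0)" using st by simp
      also have "\<dots> = 1\<^sub>m (length T2) $$ (a, b)"
        using ab st d(1) N inj[OF st(1,2)] nth_eq_iff_index_eq[OF d(1), of a b] by auto
      finally show "(P * P') $$ (a, b) = 1\<^sub>m (length T2) $$ (a, b)" .
    qed (auto simp: P_def P'_def)
    show "P' * P = 1\<^sub>m (length T2)"
    proof (rule eq_matI)
      fix a b assume "a < dim_row (1\<^sub>m (length T2))" "b < dim_col (1\<^sub>m (length T2))"
      then have ab: "a < length T2" "b < length T2" by auto
      let ?s = "T2 ! a" and ?t = "T2 ! b"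
      have st: "?s \<in> set T2" "?t \<in> set T2" using ab by auto
      have "(P' * P) $$ (a, b) = (\<Sum>c = 0..<length T2.
          (\<lambda>x. (if x = f ?s then e ?s else 0) * (if x = f ?t then e ?t else 0)) (T1 ! c))"
        using ab by (simp add: P_def P'_def scalar_prod_def)
      also have "\<dots> = (\<Sum>u\<in>set T2. (if f u = f ?s then e ?s else 0) * (if f u = f ?t then e ?t else 0))"
        by (rule s1)
      also have "\<dots> = (\<Sum>u\<in>set T2. if u = ?s then (if ?s = ?t then 1 else 0) else 0)"
        using st by (intro sum.cong) (auto simp: inj e)
      also have "\<dots> = 1\<^sub>m (length T2) $$ (a, b)"
        using ab st nth_eq_iff_index_eq[OF d(2), of a b] by auto
      finally show "(P' * P) $$ (a, b) = 1\<^sub>m (length T2) $$ (a, b)" .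
    qed (auto simp: P_def P'_def)
    fix i assume i: "i \<in> {1..<n}"
    show "A i * P = P * B i"
    proof (rule eq_matI)
      fix a b assume "a < dim_row (P * B i)" "b < dim_col (P * B i)"
      then have ab: "a < length T2" "b < length T2" using B[OF i] by (auto simp: P_def fmat_def)
      let ?t = "T2 ! b"
      obtain s where st: "s \<in> set T2" "T1 ! a = f s" "?t \<in> set T2"
        using pre ab by (meson nth_mem)
      have "(A i * P) $$ (a, b) = (\<Sum>c = 0..<length T2.
          (\<lambda>x. F i (f s) x * (if x = f ?t then e ?t else 0)) (T1 ! c))"
        using ab A[OF i] st N by (simp add: P_def fmat_def scalar_prod_def)
      also have "\<dots> = (\<Sum>u\<in>set T2. F i (f s) (f u) * (if f u = f ?t then e ?t else 0))"
        by (rule s1)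
      also have "\<dots> = (\<Sum>u\<in>set T2. if u = ?t then F i (f s) (f ?t) * e ?t else 0)"
        using st by (intro sum.cong) (auto simp: inj)
      also have "\<dots> = e s * G i s ?t" using st FG[OF i] by simp
      also have "\<dots> = (\<Sum>u\<in>set T2. if u = s then e s * G i s ?t else 0)" using st by simp
      also have "\<dots> = (\<Sum>u\<in>set T2. (if f s = f u then e u else 0) * G i u ?t)"
        using st by (intro sum.cong) (auto simp: inj)
      also have "\<dots> = (P * B i) $$ (a, b)"
        using ab B[OF i] st by (simp add: P_def fmat_def scalar_prod_def flip: s2)
      finally show "(A i * P) $$ (a, b) = (P * B i) $$ (a, b)" .
    qed (use A[OF i] B[OF i] N in \<open>auto simp: P_def fmat_def\<close>)
  qed
  then show ?thesis by (simp add: N)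
qed

definition gen_coeff :: "complex \<Rightarrow> nat \<Rightarrow> nat list \<Rightarrow> nat list \<Rightarrow> complex" where
  "gen_coeff z p s t = (if s = t then z\<^sup>2 else 0) - (1 + z\<^sup>2) *
     (if s = t then alpha z t (Suc p) else if s = swap_tab (Suc p) t then beta z t (Suc p) else 0)"

lemma rho_eq_fmat: "rho z k r lam (Suc p) = fmat (tabs k r lam) (gen_coeff z p)"
  using distinct_tabs[of k r lam]
  by (intro eq_matI)
    (auto simp: rho_def E_mat_def Let_def fmat_def gen_coeff_def nth_eq_iff_index_eq)

lemma rho_carrier: "rho z k r lam i \<in> carrier_mat (length (tabs k r lam)) (length (tabs k r lam))"
  by (auto simp: rho_def E_mat_def Let_def)

lemma braid_character_const: "c \<noteq> 0 \<Longrightarrow> braid_character n (\<lambda>_. c)"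
  by (simp add: braid_character_def)

text \<open>Cancelling the product of two neighbouring values in the braid relation leaves their
  equality.\<close>

lemma braid_character_eq_const:
  assumes "braid_character n psi"
  obtains c where "c \<noteq> 0" "\<And>i. i \<in> {1..<n} \<Longrightarrow> psi i = c"
proof (cases "1 < n")
  case True
  have nz: "psi i \<noteq> 0" if "i \<in> {1..<n}" for i using assms that by (auto simp: braid_character_def)
  have "psi i = psi 1" if "1 \<le> i" "i < n" for i
    using that
  proof (induction i rule: dec_induct)
    case (step i)
    then have i: "1 \<le> i" "i + 1 < n" by auto
    then have "psi i * psi (i + 1) * psi i = psi (i + 1) * psi i * psi (i + 1)"
      using assms unfolding braid_character_def by blast
    then have "psi i = psi (i + 1)" using nz[of i] nz[of "i + 1"] i by simp
    then show ?case using step by simp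
  qed simp
  then show ?thesis using that[of "psi 1"] nz[of 1] True by (metis atLeastLessThan_iff order_refl)
next
  case False
  \<comment> \<open>There are no generators here, so any nonzero constant will do.\<close>
  then show ?thesis by (intro that[of 1]) auto
qed

subsection \<open>The representation of a sector\<close>

locale quantum_root =
  fixes r :: nat and z :: complex
  assumes r4: "4 < r" and z_root: "z = cis (pi / real r) \<or> z = cis (- pi / real r)"
begin

section \<open>Powers of q and the coefficient alpha\<close>

definition Q :: "int \<Rightarrow> complex" where "Q m = z powi (2 * m)"

lemma z_nonzero: "z \<noteq> 0"
  using z_root by auto

lemma Q_nonzero: "Q m \<noteq> 0"
  by (simp add: Q_def z_nonzero)

lemma Q_add: "Q (a + b) = Q a * Q b"
  by (simp add: Q_def z_nonzero power_int_add distrib_left)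

lemma Q_minus: "Q (- a) = 1 / Q a"
  by (simp add: Q_def power_int_minus divide_inverse)

lemma Q_1: "Q 1 = z\<^sup>2"
  by (simp add: Q_def power_int_def numeral_2_eq_2)

lemma Q_eq_1_iff: "Q m = 1 \<longleftrightarrow> int r dvd m"
proof -
  have cis1: "cis y = 1 \<longleftrightarrow> (\<exists>j::int. y = of_int j * 2 * pi)" for y
    unfolding complex_eq_iff cos_one_2pi_int[symmetric] using cos_one_sin_zero[of y] by auto
  \<comment> \<open>The sign \<open>e\<close> treats both choices of the root at once; as
    \<open>e * e = 1\<close>, it does not affect divisibility by \<open>r\<close>.\<close>
  obtain e :: int where e: "z = cis (of_int e * (pi / real r))" "e * e = 1"
    using z_root by (elim disjE) (auto intro: that[of 1] that[of "-1"])
  have "Q m = 1 \<longleftrightarrow> (\<exists>j::int. of_int (2 * m) * (of_int e * (pi / real r)) = of_int j * 2 * pi)"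
    unfolding cis1[symmetric] Q_def by (subst e(1), subst cis_power_int) (rule refl)
  also have "\<dots> \<longleftrightarrow> (\<exists>j::int. of_int (m * e) = (of_int (j * int r) :: real))"
    using r4 by (intro arg_cong[where f = Ex] ext) (auto simp: field_simps)
  also have "\<dots> \<longleftrightarrow> int r dvd m * e"
    unfolding of_int_eq_iff by (auto simp: dvd_def mult.commute)
  also have "\<dots> \<longleftrightarrow> int r dvd m"
  proof
    assume "int r dvd m * e"
    then have "int r dvd m * e * e" by (rule dvd_mult2)
    then show "int r dvd m" using e(2) by (simp add: mult.assoc)
  qed simp
  finally show ?thesis .
qed

lemma Q_eq_iff: "Q a = Q b \<longleftrightarrow> int r dvd a - b"
proof -
  have "Q a = Q (a - b) * Q b" by (simp flip: Q_add)
  then show ?thesis using Q_eq_1_iff[of "a - b"] Q_nonzero[of b] by auto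
qed

lemma z_sq: "z\<^sup>2 \<noteq> 1" "1 + z\<^sup>2 \<noteq> 0"
proof -
  have nd: "\<not> int r dvd m" if "0 < m" "m < 4" for m :: int
    using that r4 zdvd_not_zless[of m "int r"] by simp
  show "z\<^sup>2 \<noteq> 1" using Q_eq_1_iff[of 1] nd[of 1] by (simp add: Q_1)
  have "Q 2 \<noteq> 1" using Q_eq_1_iff[of 2] nd[of 2] by simp
  then have "z\<^sup>2 * z\<^sup>2 \<noteq> 1" using Q_add[of 1 1] by (simp add: Q_1)
  then show "1 + z\<^sup>2 \<noteq> 0"
    by (metis add.commute add_eq_0_iff minus_mult_minus mult_1)
qed

text \<open>The quotient of quantum integers in \<open>alpha\<close>, rewritten in X = q^d. All half
  powers of q cancel, so only d modulo r matters.\<close>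

definition alpha_of :: "complex \<Rightarrow> complex" where
  "alpha_of X = (z\<^sup>2 * X - 1) / ((1 + z\<^sup>2) * (X - 1))"

definition step_ratio :: "nat list \<Rightarrow> nat \<Rightarrow> complex" where
  "step_ratio w p = Q (ct w p - ct w (Suc p))"

lemma alpha_eq: "alpha z w (Suc p) = alpha_of (step_ratio w p)"
proof -
  define d where "d = ct w p - ct w (Suc p)"
  define y where "y = z powi d"
  have X: "step_ratio w p = y\<^sup>2"
    unfolding step_ratio_def Q_def d_def[symmetric] y_def power2_eq_square
    using power_int_add[of z d d] z_nonzero by (simp flip: mult_2)
  have y: "y \<noteq> 0" by (simp add: y_def z_nonzero)
  have d: "dist w (Suc p) (Suc (Suc p)) = d"
    by (simp add: dist_def tcol_def trow_def d_def ct_def)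
  have q: "qint z (d + 1) = (y * z - 1 / (y * z)) / (z - 1 / z)"
    "qint z d = (y - 1 / y) / (z - 1 / z)"
    "qint z 2 = (z\<^sup>2 - 1 / z\<^sup>2) / (z - 1 / z)"
    using z_nonzero
    by (simp_all add: qint_def y_def power_int_add power_int_minus divide_inverse power_int_diff
        power_int_def[of z 2] numeral_2_eq_2)
  have f: "y * z - 1 / (y * z) = (z\<^sup>2 * y\<^sup>2 - 1) / (y * z)" "y - 1 / y = (y\<^sup>2 - 1) / y"
    "z\<^sup>2 - 1 / z\<^sup>2 = (z\<^sup>2 - 1) * (1 + z\<^sup>2) / z\<^sup>2" "z - 1 / z = (z\<^sup>2 - 1) / z"
    using y z_nonzero by (auto simp: field_simps power2_eq_square)
  have "alpha z w (Suc p) = qint z (d + 1) / (qint z 2 * qint z d)"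
    by (simp add: alpha_def d Let_def)
  also have "\<dots> = alpha_of (y\<^sup>2)"
  proof -
    \<comment> \<open>The factors are replaced by variables so that what remains is a plain field
      identity in which \<open>C\<close> cancels.\<close>
    have gen: "(N / (y * z)) / (C / z) / ((C * D / z\<^sup>2) / (C / z) * ((W / y) / (C / z))) = N / (D * W)"
      if "C \<noteq> 0" for N C D W :: complex
      using y z_nonzero that by (simp add: field_simps power2_eq_square)
    show ?thesis unfolding q f alpha_of_def by (rule gen) (use z_sq(1) in simp)
  qed
  finally show ?thesis by (simp add: X)
qed

text \<open>X becomes 1/X when the content difference changes sign: on exchanging two entries in
  different rows, and on conjugating a tableau.\<close>

lemma alpha_of_inverse:
  assumes "X \<noteq> 1" "X \<noteq> 0"
  shows "alpha_of (1 / X) = 1 - alpha_of X"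
proof -
  have "1 - alpha_of X = (X - z\<^sup>2) / ((1 + z\<^sup>2) * (X - 1))"
    using assms z_sq by (simp add: alpha_of_def diff_divide_eq_iff) (simp add: algebra_simps)
  moreover have "alpha_of (1 / X) = ((z\<^sup>2 - X) / X) / ((1 + z\<^sup>2) * ((1 - X) / X))"
    using assms by (simp add: alpha_of_def diff_divide_distrib)
  moreover have "\<dots> = (z\<^sup>2 - X) / ((1 + z\<^sup>2) * (1 - X))"
    using assms by simp
  moreover have "\<dots> = (X - z\<^sup>2) / ((1 + z\<^sup>2) * (X - 1))"
    by (metis (no_types, lifting) minus_diff_eq minus_divide_divide mult_minus_right)
  ultimately show ?thesis by simp
qed

lemma diagonal_coeff:
  "X \<noteq> 1 \<Longrightarrow> z\<^sup>2 - (1 + z\<^sup>2) * alpha_of X = (1 - z\<^sup>2) / (X - 1)"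
  using z_sq by (simp add: alpha_of_def diff_divide_eq_iff) (simp add: algebra_simps)

end

text \<open>The bounds say that \<open>k\<close> and \<open>r - k\<close> are both at least 2, so
  sectors are closed under conjugation.\<close>

locale sector = quantum_root +
  fixes k :: nat and lam :: "nat list" and n :: nat
  assumes k2: "2 \<le> k" and kr: "k < r - 1" and young_lam: "young lam"
    and adm_lam: "adm_fun k r (rowlen lam)" and size_lam: "sum_list lam = n"
begin

abbreviation "T \<equiv> tabs k r lam"

lemma T_iff: "w \<in> set T \<longleftrightarrow> path k r w \<and> has_shape w lam"
  using k2 kr by (simp add: set_tabs)

lemma T_length: "w \<in> set T \<Longrightarrow> length w = n"
  using has_shape_length[of w lam] T_iff size_lam by simp

lemma T_nonempty: "0 < length T"
  using tabs_nonempty[OF young_lam adm_lam k2] kr by simp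

lemma step_ratio_neq:
  assumes "w \<in> set T" "Suc p < n"
  shows "step_ratio w p \<noteq> 1" "step_ratio w p \<noteq> 0"
proof -
  show "step_ratio w p \<noteq> 1"
    using ct_Suc_distinct[of k r w p] assms T_length[of w] T_iff kr
    unfolding step_ratio_def Q_eq_1_iff by simp
  show "step_ratio w p \<noteq> 0" by (simp add: step_ratio_def Q_nonzero)
qed

lemma alpha_T: "w \<in> set T \<Longrightarrow> Suc p < n \<Longrightarrow> alpha z w (Suc p) = alpha_of (step_ratio w p)"
  by (rule alpha_eq)

lemma beta_T: "w \<in> set T \<Longrightarrow> Suc p < n \<Longrightarrow>
    beta z w (Suc p) = csqrt (alpha_of (step_ratio w p) * (1 - alpha_of (step_ratio w p)))"
  by (simp add: beta_def alpha_T)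

lemma gen_coeff_diag: "w \<in> set T \<Longrightarrow> Suc p < n \<Longrightarrow>
    gen_coeff z p w w = (1 - z\<^sup>2) / (step_ratio w p - 1)"
  by (simp add: gen_coeff_def alpha_T diagonal_coeff step_ratio_neq)

lemma swap_swap_T: "w \<in> set T \<Longrightarrow> Suc p < n \<Longrightarrow> swap_tab (Suc p) (swap_tab (Suc p) w) = w"
  using swap_tab_swap_tab T_length by simp

lemma swap_T_neq: "w \<in> set T \<Longrightarrow> Suc p < n \<Longrightarrow> swap_tab (Suc p) w \<noteq> w \<longleftrightarrow> w ! p \<noteq> w ! Suc p"
  using swap_tab_eq_self_iff T_length by simp

lemma step_ratio_swap:
  assumes "w \<in> set T" "Suc p < n" "swap_tab (Suc p) w \<noteq> w"
  shows "step_ratio (swap_tab (Suc p) w) p = 1 / step_ratio w p"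
proof -
  have "ct (swap_tab (Suc p) w) p = ct w (Suc p)" "ct (swap_tab (Suc p) w) (Suc p) = ct w p"
    using ct_swap_tab[of p w] assms swap_T_neq[of w p] T_length[of w] by auto
  then show ?thesis by (simp add: step_ratio_def flip: Q_minus)
qed

lemma swap_coeffs:
  assumes "w \<in> set T" "swap_tab (Suc p) w \<in> set T" "Suc p < n" "swap_tab (Suc p) w \<noteq> w"
  shows "alpha z (swap_tab (Suc p) w) (Suc p) = 1 - alpha z w (Suc p)"
    "beta z (swap_tab (Suc p) w) (Suc p) = beta z w (Suc p)"
  using assms step_ratio_swap[OF assms(1,3,4)] step_ratio_neq[OF assms(1,3)]
  by (simp_all add: alpha_T beta_T alpha_of_inverse mult.commute)

text \<open>A tableau without a partner spans an invariant line of E, so idempotency demands the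
  value 0 or 1. Two entries in one row give X = 1/q and the value 0; an inadmissible exchange gives
  X = q and the value 1.\<close>

lemma alpha_no_swap:
  assumes "w \<in> set T" "Suc p < n" "swap_tab (Suc p) w = w \<or> swap_tab (Suc p) w \<notin> set T"
  shows "alpha z w (Suc p) = 0 \<or> alpha z w (Suc p) = 1"
proof -
  note z = z_nonzero z_sq
  have w: "path k r w" "has_shape w lam" "length w = n" using assms T_iff T_length by auto
  have "step_ratio w p = 1 / z\<^sup>2 \<or> step_ratio w p = z\<^sup>2"
  proof (cases "w ! p = w ! Suc p")
    case True
    then have "ct w p - ct w (Suc p) = - 1" using ct_Suc_same[of p w] assms w by simp
    then have "step_ratio w p = Q (- 1)" by (simp add: step_ratio_def)
    then show ?thesis using Q_minus[of 1] by (simp add: Q_1)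
  next
    case False
    then have "swap_tab (Suc p) w \<notin> set T" using assms swap_T_neq by blast
    then have "\<not> path k r (swap_tab (Suc p) w)"
      using w assms(2) T_iff by (simp add: has_shape_def cnt_swap_tab)
    then have "int r dvd ct w p - ct w (Suc p) - 1"
      using ct_Suc_swap_not_path[of k r w p] False w assms(2) k2 kr by simp
    then have "step_ratio w p = z\<^sup>2" unfolding step_ratio_def Q_1[symmetric] Q_eq_iff .
    then show ?thesis by simp
  qed
  moreover have "alpha_of (1 / z\<^sup>2) = 0" using z by (simp add: alpha_of_def)
  moreover have "alpha_of (z\<^sup>2) = 1"
    using z by (simp add: alpha_of_def) (simp add: algebra_simps)
  ultimately show ?thesis using alpha_T assms by auto
qed

definition proj_coeff :: "nat \<Rightarrow> nat list \<Rightarrow> nat list \<Rightarrow> complex" where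
  "proj_coeff p s t =
     (if s = t then alpha z t (Suc p) else if s = swap_tab (Suc p) t then beta z t (Suc p) else 0)"

lemma proj_coeff_sym:
  assumes "s \<in> set T" "t \<in> set T" "Suc p < n"
  shows "proj_coeff p s t = proj_coeff p t s"
proof (cases "s = t \<or> s \<noteq> swap_tab (Suc p) t")
  case True
  then show ?thesis using swap_swap_T[OF assms(1,3)] by (auto simp: proj_coeff_def)
next
  case False
  then show ?thesis
    using swap_coeffs(2)[OF assms(2) _ assms(3)] swap_swap_T[OF assms(2,3)] assms(1)
    by (auto simp: proj_coeff_def)
qed

lemma gen_coeff_sym:
  "s \<in> set T \<Longrightarrow> t \<in> set T \<Longrightarrow> Suc p < n \<Longrightarrow> gen_coeff z p s t = gen_coeff z p t s"
  using proj_coeff_sym[of s t p] by (simp add: gen_coeff_def proj_coeff_def[abs_def])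

text \<open>E splits into blocks of size one, settled by \<open>alpha_no_swap\<close>, and blocks of
  size two with diagonal a, 1 - a and off-diagonal entry b, where b^2 = a (1 - a) because
  \<open>beta\<close> is a square root.\<close>

lemma proj_coeff_idem:
  assumes st: "s \<in> set T" "t \<in> set T" and p: "Suc p < n"
  shows "(\<Sum>u\<in>set T. proj_coeff p s u * proj_coeff p u t) = proj_coeff p s t"
proof (cases "swap_tab (Suc p) s \<noteq> s \<and> swap_tab (Suc p) s \<in> set T")
  case True
  define s' where "s' = swap_tab (Suc p) s"
  have s': "s' \<in> set T" "s' \<noteq> s" "swap_tab (Suc p) s' = s" "swap_tab (Suc p) s = s'"
    using True swap_swap_T[OF st(1) p] by (auto simp: s'_def)
  have z0: "proj_coeff p s u = 0" if "u \<in> set T" "u \<noteq> s" "u \<noteq> s'" for u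
    using that swap_swap_T[OF that(1) p] by (auto simp: proj_coeff_def s'_def)
  have "(\<Sum>u\<in>set T. proj_coeff p s u * proj_coeff p u t) =
      (\<Sum>u\<in>{s, s'}. proj_coeff p s u * proj_coeff p u t)"
    using st s' z0 by (intro sum.mono_neutral_right) auto
  also have "\<dots> = proj_coeff p s s * proj_coeff p s t + proj_coeff p s s' * proj_coeff p s' t"
    using s' by simp
  also have "\<dots> = proj_coeff p s t"
  proof -
    let ?a = "alpha z s (Suc p)" and ?b = "beta z s (Suc p)"
    have b2: "?b * ?b = ?a * (1 - ?a)" by (simp add: beta_def flip: power2_eq_square)
    have sc: "alpha z s' (Suc p) = 1 - ?a" "beta z s' (Suc p) = ?b"
      using swap_coeffs[of s p] st s' p by auto
    have v: "proj_coeff p s s = ?a" "proj_coeff p s s' = ?b" "proj_coeff p s' s = ?b"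
      "proj_coeff p s' s' = 1 - ?a"
      using s' sc by (auto simp: proj_coeff_def)
    consider "t = s" | "t = s'" | "t \<noteq> s" "t \<noteq> s'" by blast
    then show ?thesis
    proof cases
      case 3
      then have "proj_coeff p s' t = 0"
        using s' swap_swap_T[OF st(2) p] by (auto simp: proj_coeff_def)
      then show ?thesis using z0[OF st(2)] 3 by simp
    qed (simp_all add: v b2 algebra_simps)
  qed
  finally show ?thesis .
next
  case False
  have z0: "proj_coeff p s u = 0" if "u \<in> set T" "u \<noteq> s" for u
    using that False swap_swap_T[OF that(1) p] by (auto simp: proj_coeff_def)
  have "(\<Sum>u\<in>set T. proj_coeff p s u * proj_coeff p u t) =
      (\<Sum>u\<in>{s}. proj_coeff p s u * proj_coeff p u t)"
    using st z0 by (intro sum.mono_neutral_right) auto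
  also have "\<dots> = proj_coeff p s t"
  proof (cases "t = s")
    case True
    then show ?thesis using alpha_no_swap[OF st(1) p] False by (auto simp: proj_coeff_def)
  qed (simp add: z0 st)
  finally show ?thesis .
qed

text \<open>The Hecke relation \<sigma>^2 = (q - 1) \<sigma> + q, a consequence of \<sigma> = q - (1
  + q) E and E^2 = E.\<close>

lemma gen_coeff_quadratic:
  assumes st: "s \<in> set T" "t \<in> set T" and p: "Suc p < n"
  shows "(\<Sum>u\<in>set T. gen_coeff z p s u * gen_coeff z p u t) =
    (z\<^sup>2 - 1) * gen_coeff z p s t + (if s = t then z\<^sup>2 else 0)"
proof -
  let ?E = "proj_coeff p" and ?q = "z\<^sup>2"
  have g: "gen_coeff z p s t = (if s = t then ?q else 0) - (1 + ?q) * ?E s t" for s t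
    by (simp add: gen_coeff_def proj_coeff_def)
  have "(\<Sum>u\<in>set T. gen_coeff z p s u * gen_coeff z p u t) =
    (\<Sum>u\<in>set T. (if u = s then if s = t then ?q * ?q else 0 else 0)
       - (if u = s then ?q * (1 + ?q) * ?E s t else 0)
       - (if u = t then ?q * (1 + ?q) * ?E s t else 0)
       + (1 + ?q) * (1 + ?q) * (?E s u * ?E u t))"
    by (intro sum.cong) (auto simp: g algebra_simps)
  also have "\<dots> = (if s = t then ?q * ?q else 0) - ?q * (1 + ?q) * ?E s t - ?q * (1 + ?q) * ?E s t
      + (1 + ?q) * (1 + ?q) * ?E s t"
    using st proj_coeff_idem[OF st p]
    by (simp add: sum.distrib sum_subtractf flip: sum_distrib_left)
  also have "\<dots> = (?q - 1) * gen_coeff z p s t + (if s = t then ?q else 0)"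
    by (simp add: g algebra_simps)
  finally show ?thesis .
qed

text \<open>Entrywise form of L_p \<sigma> = q \<sigma>^-1 L_{p+1}, with \<sigma> - (q - 1) written
  for q \<sigma>^-1. Off the diagonal it holds because an exchange swaps the two contents; on the
  diagonal it is an identity for (1 - q) / (X - 1).\<close>

lemma gen_coeff_bernstein:
  assumes "u \<in> set T" "t \<in> set T" "Suc p < n"
  shows "Q (ct u p) * gen_coeff z p u t =
    (gen_coeff z p u t - (if u = t then z\<^sup>2 - 1 else 0)) * Q (ct t (Suc p))"
proof (cases "u = t")
  case True
  let ?X = "step_ratio t p"
  have X: "Q (ct t p) = ?X * Q (ct t (Suc p))"
    by (simp add: step_ratio_def flip: Q_add)
  have "?X * ((1 - z\<^sup>2) / (?X - 1)) = (1 - z\<^sup>2) / (?X - 1) - (z\<^sup>2 - 1)"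
    using step_ratio_neq[OF assms(2,3)]
    by (simp add: diff_divide_eq_iff eq_divide_eq divide_diff_eq_iff) (simp add: algebra_simps)
  then have "?X * gen_coeff z p t t = gen_coeff z p t t - (z\<^sup>2 - 1)"
    by (simp only: gen_coeff_diag[OF assms(2,3)])
  then have "?X * gen_coeff z p t t * Q (ct t (Suc p)) =
      (gen_coeff z p t t - (z\<^sup>2 - 1)) * Q (ct t (Suc p))" by (rule arg_cong)
  then show ?thesis unfolding True X by (simp only: mult_ac simp_thms if_True)
next
  case False
  show ?thesis
  proof (cases "u = swap_tab (Suc p) t")
    case True
    then have "ct u p = ct t (Suc p)"
      using ct_swap_tab(1)[of p t] assms swap_T_neq[of t p] T_length[of t] False by auto
    then show ?thesis using False by simp
  qed (use False in \<open>simp add: gen_coeff_def\<close>)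
qed

section \<open>Jucys-Murphy elements\<close>

abbreviation "R p \<equiv> rho z k r lam (Suc p)"

abbreviation "N \<equiv> length T"

definition JM :: "nat \<Rightarrow> complex mat" where
  "JM p = mat_diag N (\<lambda>a. Q (ct (T ! a) p))"

lemma JM_carrier [simp]: "JM p \<in> carrier_mat N N"
  by (simp add: JM_def)

lemma JM_eq_fmat: "JM p = fmat T (\<lambda>s t. if s = t then Q (ct t p) else 0)"
  using distinct_tabs[of k r lam]
  by (intro eq_matI) (auto simp: JM_def mat_diag_def fmat_def nth_eq_iff_index_eq)

lemma R_carrier [simp]: "R p \<in> carrier_mat N N"
  by (rule rho_carrier)

text \<open>\<open>gen_coeff_bernstein\<close> moves the Jucys-Murphy element to the right and
  leaves \<sigma> (\<sigma> - (q - 1)), which the quadratic relation reduces to q.\<close>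

lemma JM_Suc:
  assumes p: "Suc p < n"
  shows "R p * (JM p * R p) = z\<^sup>2 \<cdot>\<^sub>m JM (Suc p)"
proof -
  let ?g = "gen_coeff z p"
  have d: "distinct T" by (rule distinct_tabs)
  have "JM p * R p = fmat T (\<lambda>s t. Q (ct s p) * ?g s t)"
    unfolding JM_eq_fmat rho_eq_fmat fmat_mult[OF d]
    by (intro fmat_cong) (simp add: if_distrib[of "\<lambda>x. x * _"] cong: if_cong)
  then have "R p * (JM p * R p) = fmat T (\<lambda>s t. \<Sum>u\<in>set T. ?g s u * (Q (ct u p) * ?g u t))"
    by (simp add: rho_eq_fmat fmat_mult[OF d])
  also have "\<dots> = fmat T (\<lambda>s t. if s = t then z\<^sup>2 * Q (ct t (Suc p)) else 0)"
  proof (rule fmat_cong)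
    fix s t assume st: "s \<in> set T" "t \<in> set T"
    have "(\<Sum>u\<in>set T. ?g s u * (Q (ct u p) * ?g u t)) =
        (\<Sum>u\<in>set T. (?g s u * ?g u t - (if u = t then (z\<^sup>2 - 1) * ?g s t else 0)) * Q (ct t (Suc p)))"
      by (intro sum.cong refl, subst gen_coeff_bernstein[OF _ st(2) p]) (auto simp: algebra_simps)
    also have "\<dots> = ((\<Sum>u\<in>set T. ?g s u * ?g u t) - (z\<^sup>2 - 1) * ?g s t) * Q (ct t (Suc p))"
      using st by (simp add: sum_subtractf flip: sum_distrib_right)
    also have "\<dots> = (if s = t then z\<^sup>2 * Q (ct t (Suc p)) else 0)"
      unfolding gen_coeff_quadratic[OF st p] by simp
    finally show "(\<Sum>u\<in>set T. ?g s u * (Q (ct u p) * ?g u t)) =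
        (if s = t then z\<^sup>2 * Q (ct t (Suc p)) else 0)" .
  qed
  also have "\<dots> = z\<^sup>2 \<cdot>\<^sub>m JM (Suc p)"
    unfolding JM_eq_fmat by (auto simp: fmat_def intro!: eq_matI)
  finally show ?thesis .
qed

lemma R_quadratic:
  assumes p: "Suc p < n"
  shows "R p * R p = (z\<^sup>2 - 1) \<cdot>\<^sub>m R p + z\<^sup>2 \<cdot>\<^sub>m 1\<^sub>m N"
proof -
  have d: "distinct T" by (rule distinct_tabs)
  have "R p * R p = fmat T (\<lambda>s t. (z\<^sup>2 - 1) * gen_coeff z p s t + (if s = t then z\<^sup>2 else 0))"
    unfolding rho_eq_fmat fmat_mult[OF d]
    using gen_coeff_quadratic p by (intro fmat_cong) simp
  also have "\<dots> = (z\<^sup>2 - 1) \<cdot>\<^sub>m R p + z\<^sup>2 \<cdot>\<^sub>m 1\<^sub>m N"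
    using d unfolding rho_eq_fmat fmat_one[OF d, symmetric]
    by (intro eq_matI) (auto simp: fmat_def)
  finally show ?thesis .
qed

lemma JM_0:
  assumes "0 < n"
  shows "JM 0 = 1\<^sub>m N"
proof -
  have "ct w 0 = 0" if "w \<in> set T" for w
  proof -
    have w: "path k r w" "length w = n" using that T_iff T_length by auto
    have "adm_fun k r (\<lambda>j. cnt j (take 1 w))" by (rule path_adm_fun[OF path_take[OF w(1)]])
    moreover have "take 1 w = [w ! 0]" using w(2) assms by (cases w) auto
    ultimately have *: "cnt (Suc j) [w ! 0] \<le> cnt j [w ! 0]" for j unfolding adm_fun_def by metis
    have "w ! 0 = 0" using *[of "w ! 0 - 1"] by (cases "w ! 0") auto
    then show ?thesis by (simp add: ct_def)
  qed
  then have "Q (ct (T ! a) 0) = 1" if "a < N" for a using that Q_eq_1_iff[of 0] by simp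
  then show ?thesis by (intro eq_matI) (auto simp: JM_def mat_diag_def)
qed

text \<open>The quadratic relation provides the inverse (\<sigma> - (q - 1)) / q, and the matrices
  are symmetric, so transposing changes nothing.\<close>

lemma contragredient_eq:
  assumes p: "Suc p < n"
  shows "contragredient (rho z k r lam) (Suc p) =
    fmat T (\<lambda>s t. (gen_coeff z p s t - (if s = t then z\<^sup>2 - 1 else 0)) / z\<^sup>2)"
proof -
  have d: "distinct T" by (rule distinct_tabs)
  let ?h = "\<lambda>s t. (gen_coeff z p s t - (if s = t then z\<^sup>2 - 1 else 0)) / z\<^sup>2"
  have z2: "z\<^sup>2 \<noteq> 0" using z_nonzero by simp
  have "R p * fmat T ?h = fmat T (\<lambda>s t. if s = t then 1 else 0)"
    unfolding rho_eq_fmat fmat_mult[OF d]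
  proof (rule fmat_cong)
    fix s t assume st: "s \<in> set T" "t \<in> set T"
    have "(\<Sum>u\<in>set T. gen_coeff z p s u * ?h u t) =
        (\<Sum>u\<in>set T. (gen_coeff z p s u * gen_coeff z p u t
           - (if u = t then (z\<^sup>2 - 1) * gen_coeff z p s t else 0)) / z\<^sup>2)"
      by (intro sum.cong) (auto simp: algebra_simps)
    also have "\<dots> = ((\<Sum>u\<in>set T. gen_coeff z p s u * gen_coeff z p u t)
        - (z\<^sup>2 - 1) * gen_coeff z p s t) / z\<^sup>2"
      using st by (simp add: sum_subtractf flip: sum_divide_distrib)
    also have "\<dots> = (if s = t then 1 else 0)"
      unfolding gen_coeff_quadratic[OF st p] using z2 by simp
    finally show "(\<Sum>u\<in>set T. gen_coeff z p s u * ?h u t) = (if s = t then 1 else 0)" .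
  qed
  then have 1: "R p * fmat T ?h = 1\<^sub>m N" by (simp add: fmat_one[OF d])
  have "fmat T ?h * R p = fmat T (\<lambda>s t. if s = t then 1 else 0)"
    unfolding rho_eq_fmat fmat_mult[OF d]
  proof (rule fmat_cong)
    fix s t assume st: "s \<in> set T" "t \<in> set T"
    have "(\<Sum>u\<in>set T. ?h s u * gen_coeff z p u t) =
        (\<Sum>u\<in>set T. (gen_coeff z p s u * gen_coeff z p u t
           - (if u = s then (z\<^sup>2 - 1) * gen_coeff z p s t else 0)) / z\<^sup>2)"
      by (intro sum.cong) (auto simp: algebra_simps)
    also have "\<dots> = ((\<Sum>u\<in>set T. gen_coeff z p s u * gen_coeff z p u t)
        - (z\<^sup>2 - 1) * gen_coeff z p s t) / z\<^sup>2"
      using st by (simp add: sum_subtractf flip: sum_divide_distrib)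
    also have "\<dots> = (if s = t then 1 else 0)"
      unfolding gen_coeff_quadratic[OF st p] using z2 by simp
    finally show "(\<Sum>u\<in>set T. ?h s u * gen_coeff z p u t) = (if s = t then 1 else 0)" .
  qed
  then have 2: "fmat T ?h * R p = 1\<^sub>m N" by (simp add: fmat_one[OF d])
  have "mat_inverse (R p) = Some (fmat T ?h)"
    by (rule mat_inverse_eqI[OF _ _ 1 2]) auto
  then have "contragredient (rho z k r lam) (Suc p) = fmat T (\<lambda>s t. ?h t s)"
    unfolding contragredient_def by (auto simp: fmat_def intro!: eq_matI)
  also have "\<dots> = fmat T ?h"
    using gen_coeff_sym p by (intro fmat_cong) auto
  finally show ?thesis .
qed

section \<open>Sectors related by conjugation or by a change of width\<close>

lemma sector_conj: "sector r z (r - k) (r_conj k r lam) n"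
proof
  have "T ! 0 \<in> set T" using T_nonempty by simp
  then have w: "path k r (T ! 0)" "has_shape (T ! 0) lam" "length (T ! 0) = n"
    using T_iff T_length by auto
  have "has_shape (conj_word (r - k) (T ! 0)) (r_conj k r lam)"
    using has_shape_conj_word[OF w(1,2)] kr by simp
  then show "sum_list (r_conj k r lam) = n" using has_shape_length w(3) by fastforce
  show "young (r_conj k r lam)" "adm_fun (r - k) r (rowlen (r_conj k r lam))"
    using young_r_conj[of k r lam] adm_fun_r_conj[of k r lam] k2 kr by auto
qed (use k2 kr in auto)

text \<open>By \<open>contragredient_eq\<close> the twisted contragredient is (q - 1) - \<sigma>.
  Its diagonal is that of the conjugate sector, where every X is inverted; its off-diagonal entries
  agree up to the sign that \<open>word_sign\<close> corrects.\<close>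

lemma rep_equiv_conj:
  "rep_equiv n (length (tabs (r - k) r (r_conj k r lam))) (rho z (r - k) r (r_conj k r lam))
     N (tensor_char (\<lambda>_. - z\<^sup>2) (contragredient (rho z k r lam)))"
proof -
  let ?l = "r - k" and ?mu = "r_conj k r lam"
  let ?f = "conj_word ?l"
  interpret C: sector r z ?l ?mu n by (rule sector_conj)
  have bij: "bij_betw ?f (set T) (set C.T)"
    by (rule bij_betw_conj_word[OF young_lam adm_lam k2 kr])
  have fC: "?f w \<in> set C.T" if "w \<in> set T" for w using bij that by (auto simp: bij_betw_def)
  have ff: "conj_word k (?f w) = w" if "w \<in> set T" for w
    using conj_word_conj_word[of k r w ?l] that T_iff k2 kr by simp
  have ratio: "step_ratio (?f w) p = 1 / step_ratio w p" if w: "w \<in> set T" "Suc p < n" for w p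
  proof -
    have c: "int r dvd ct (?f w) m + ct w m" if "m < n" for m
      using ct_conj_word[of k r w m ?l] w that T_iff T_length[of w] k2 kr by simp
    have "int r dvd (ct (?f w) p + ct w p) - (ct (?f w) (Suc p) + ct w (Suc p))"
      using w(2) by (intro dvd_diff c) auto
    then have "int r dvd (ct (?f w) p - ct (?f w) (Suc p)) - (- (ct w p - ct w (Suc p)))"
      by (simp add: algebra_simps)
    then show ?thesis unfolding step_ratio_def Q_minus[symmetric] Q_eq_iff .
  qed
  have swap: "?f (swap_tab (Suc p) w) = swap_tab (Suc p) (?f w)"
    if "w \<in> set T" "Suc p < n" "swap_tab (Suc p) w \<noteq> w" for w p
    using conj_word_swap_tab[of p w] that swap_T_neq[of w p] T_length[of w] by simp
  have swap': "conj_word k (swap_tab (Suc p) v) = swap_tab (Suc p) (conj_word k v)"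
    if "v \<in> set C.T" "Suc p < n" "swap_tab (Suc p) v \<noteq> v" for v p
    using conj_word_swap_tab[of p v] that C.swap_T_neq[of v p] C.T_length[of v] by simp
  show ?thesis
  proof (rule rep_equiv_fmat[OF distinct_tabs distinct_tabs bij, where e = word_sign
        and F = "\<lambda>i. gen_coeff z (i - 1)"
        and G = "\<lambda>i s t. (if s = t then z\<^sup>2 - 1 else 0) - gen_coeff z (i - 1) s t"])
    fix i assume i: "i \<in> {1..<n}"
    then obtain p where p: "i = Suc p" "Suc p < n" by (cases i) auto
    show "rho z ?l r ?mu i = fmat C.T (gen_coeff z (i - 1))"
      by (simp add: p(1) rho_eq_fmat)
    show "tensor_char (\<lambda>_. - z\<^sup>2) (contragredient (rho z k r lam)) i =
        fmat T (\<lambda>s t. (if s = t then z\<^sup>2 - 1 else 0) - gen_coeff z (i - 1) s t)"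
      unfolding tensor_char_def p(1) contragredient_eq[OF p(2)]
      using z_nonzero by (intro eq_matI) (auto simp: fmat_def)
    fix s t assume st: "s \<in> set T" "t \<in> set T"
    let ?g = "gen_coeff z p"
    have "?g (?f s) (?f t) * word_sign t = word_sign s * ((if s = t then z\<^sup>2 - 1 else 0) - ?g s t)"
    proof (cases "s = t")
      case True
      let ?X = "step_ratio t p"
      have X: "?X \<noteq> 1" "?X \<noteq> 0" using step_ratio_neq[OF st(2) p(2)] by auto
      have "?g (?f t) (?f t) = (1 - z\<^sup>2) / (1 / ?X - 1)"
        using C.gen_coeff_diag[OF fC[OF st(2)] p(2)] ratio[OF st(2) p(2)] by simp
      also have "\<dots> = (z\<^sup>2 - 1) - (1 - z\<^sup>2) / (?X - 1)"
      proof -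
        have 1: "1 / ?X - 1 = (1 - ?X) / ?X" using X by (simp add: diff_divide_distrib)
        have "(1 - z\<^sup>2) / (1 / ?X - 1) = (1 - z\<^sup>2) * ?X / (1 - ?X)" unfolding 1 by simp
        also have "\<dots> = (z\<^sup>2 - 1) - (1 - z\<^sup>2) / (?X - 1)"
          using X by (simp add: frac_eq_eq diff_divide_eq_iff) (simp add: algebra_simps)
        finally show ?thesis .
      qed
      finally show ?thesis using True gen_coeff_diag[OF st(2) p(2)] by (simp add: mult.commute)
    next
      case neq: False
      then have fneq: "?f s \<noteq> ?f t" using ff st by metis
      show ?thesis
      proof (cases "s = swap_tab (Suc p) t")
        case True
        have sw: "?f s = swap_tab (Suc p) (?f t)" using swap[OF st(2) p(2)] True neq by auto
        have "beta z (?f t) (Suc p) = beta z t (Suc p)"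
          using C.beta_T[OF fC[OF st(2)] p(2)] beta_T[OF st(2) p(2)] ratio[OF st(2) p(2)]
            alpha_of_inverse[OF step_ratio_neq[OF st(2) p(2)]] by (simp add: mult.commute)
        moreover have "word_sign s = - word_sign t"
          using word_sign_swap_tab[of p t] True neq swap_T_neq[OF st(2) p(2)] T_length[OF st(2)] p(2)
          by auto
        ultimately show ?thesis using neq fneq True sw by (simp add: gen_coeff_def)
      next
        case False
        \<comment> \<open>Conjugating back shows that no exchange appears among the images that was
          absent among the original tableaux.\<close>
        have "?f s \<noteq> swap_tab (Suc p) (?f t)"
        proof
          assume a: "?f s = swap_tab (Suc p) (?f t)"
          then have "conj_word k (?f s) = swap_tab (Suc p) (conj_word k (?f t))"
            using swap'[OF fC[OF st(2)] p(2)] fneq by simp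
          then show False using ff st False by simp
        qed
        then show ?thesis using neq False fneq by (simp add: gen_coeff_def)
      qed
    qed
    then show "gen_coeff z (i - 1) (?f s) (?f t) * word_sign t =
        word_sign s * ((if s = t then z\<^sup>2 - 1 else 0) - gen_coeff z (i - 1) s t)"
      by (simp add: p(1))
  qed (rule word_sign_sq)
qed

text \<open>Both widths admit the same tableaux, but enumerate them from different alphabets; the
  intertwiner only matches the two enumerations.\<close>

lemma rep_equiv_change_width:
  assumes "sector r z k' lam n"
  shows "rep_equiv n N (rho z k r lam) (length (tabs k' r lam)) (tensor_char (\<lambda>_. 1) (rho z k' r lam))"
proof -
  interpret C: sector r z k' lam n by fact
  have "w \<in> set T \<longleftrightarrow> w \<in> set C.T" for w
  proof -
    have *: "(\<lambda>j. cnt j w) = rowlen lam" if "has_shape w lam" using that by (auto simp: has_shape_def)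
    show ?thesis
      unfolding T_iff C.T_iff
      using path_change_width[of k r w k'] path_change_width[of k' r w k] * adm_lam C.adm_lam
        k2 kr C.k2 C.kr by auto
  qed
  then have eq: "set T = set C.T" by blast
  show ?thesis
  proof (rule rep_equiv_fmat[OF distinct_tabs distinct_tabs, where f = "\<lambda>w. w" and e = "\<lambda>_. 1"
        and F = "\<lambda>i. gen_coeff z (i - 1)" and G = "\<lambda>i. gen_coeff z (i - 1)"])
    show "bij_betw (\<lambda>w. w) (set C.T) (set T)" unfolding eq by (simp add: bij_betw_def inj_on_def)
    fix i assume "i \<in> {1..<n}"
    then obtain p where p: "i = Suc p" by (cases i) auto
    show "rho z k r lam i = fmat T (gen_coeff z (i - 1))"
      "tensor_char (\<lambda>_. 1) (rho z k' r lam) i = fmat C.T (gen_coeff z (i - 1))"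
      by (simp_all add: p rho_eq_fmat tensor_char_def one_smult_mat)
  qed auto
qed

section \<open>From an equivalence back to the diagram\<close>

lemma generic_step:
  assumes "\<not> trivial_type k r lam"
  obtains w p where "w \<in> set T" "Suc p < n" "step_ratio w p \<noteq> z\<^sup>2" "step_ratio w p \<noteq> 1 / z\<^sup>2"
proof -
  have w: "T ! 0 \<in> set T" using T_nonempty by simp
  then obtain p where p: "Suc p < length (T ! 0)"
    "\<not> int r dvd ct (T ! 0) p - ct (T ! 0) (Suc p) - 1"
    "\<not> int r dvd ct (T ! 0) p - ct (T ! 0) (Suc p) + 1"
    using exists_generic_step[of k r "T ! 0" lam] T_iff young_lam k2 kr assms by metis
  show ?thesis
  proof (rule that[OF w])
    show "Suc p < n" using p(1) T_length[OF w] by simp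
    show "step_ratio (T ! 0) p \<noteq> z\<^sup>2"
      unfolding step_ratio_def Q_1[symmetric] Q_eq_iff using p(2) .
    have "1 / z\<^sup>2 = Q (- 1)" using Q_minus[of 1] by (simp add: Q_1)
    then show "step_ratio (T ! 0) p \<noteq> 1 / z\<^sup>2"
      unfolding step_ratio_def using Q_eq_iff[of _ "- 1"] p(3) by simp
  qed
qed

text \<open>Both \<open>\<sigma>\<close> and its twist satisfy a quadratic relation; for \<open>c \<noteq> 1\<close> their difference would make
  every \<open>\<sigma>\<^sub>p\<close> scalar.\<close>

lemma twist_trivial:
  assumes S: "sector r z k' lam' n"
    and P: "length (tabs k' r lam') = N" "P \<in> carrier_mat N N" "P' \<in> carrier_mat N N" "P * P' = 1\<^sub>m N"
    and int: "\<And>p. Suc p < n \<Longrightarrow> R p * P = P * (c \<cdot>\<^sub>m rho z k' r lam' (Suc p))"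
    and nt: "\<not> trivial_type k r lam"
  shows "c = 1"
proof (rule ccontr)
  assume c: "c \<noteq> 1"
  interpret C: sector r z k' lam' n by fact
  obtain w p where w: "w \<in> set T" "Suc p < n" "step_ratio w p \<noteq> z\<^sup>2" "step_ratio w p \<noteq> 1 / z\<^sup>2"
    using generic_step[OF nt] .
  let ?A = "R p" and ?B = "C.R p" and ?q = "z\<^sup>2"
  have cA: "?A \<in> carrier_mat N N" and cB: "?B \<in> carrier_mat N N"
    using C.R_carrier[of p] by (auto simp: P(1))
  have AP: "?A * P = c \<cdot>\<^sub>m (P * ?B)"
    using int[OF w(2)] P cB by (simp add: mult_smult_distrib[of _ N N _ N])
  have "(?A * ?A) * P = ?A * (?A * P)" by (rule assoc_mult_mat[OF cA cA P(2)])
  also have "\<dots> = ?A * (c \<cdot>\<^sub>m (P * ?B))" by (simp only: AP)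
  also have "\<dots> = c \<cdot>\<^sub>m (?A * (P * ?B))"
    by (rule mult_smult_distrib[OF cA mult_carrier_mat[OF P(2) cB]])
  also have "?A * (P * ?B) = ?A * P * ?B" by (rule assoc_mult_mat[OF cA P(2) cB, symmetric])
  also have "\<dots> = c \<cdot>\<^sub>m (P * (?B * ?B))"
    unfolding AP using P cB
    by (simp add: mult_smult_assoc_mat[of _ N N _ N] smult_smult_mat assoc_mult_mat[of _ N N _ N _ N])
  also have "P * (?B * ?B) = (?q - 1) \<cdot>\<^sub>m (P * ?B) + ?q \<cdot>\<^sub>m P"
    unfolding C.R_quadratic[OF w(2)] unfolding P(1) using smult_add_one_mult(2)[OF cB P(2)] .
  also have "c \<cdot>\<^sub>m (c \<cdot>\<^sub>m \<dots>) = (c * (?q - 1)) \<cdot>\<^sub>m (?A * P) + (c * c * ?q) \<cdot>\<^sub>m P"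
    unfolding AP using P cB by (intro eq_matI) (auto simp: algebra_simps)
  also have "(?A * ?A) * P = (?q - 1) \<cdot>\<^sub>m (?A * P) + ?q \<cdot>\<^sub>m P"
    unfolding R_quadratic[OF w(2)] using smult_add_one_mult(1)[OF cA P(2)] .
  finally have eq: "(?q - 1) \<cdot>\<^sub>m (?A * P) + ?q \<cdot>\<^sub>m P =
      (c * (?q - 1)) \<cdot>\<^sub>m (?A * P) + (c * c * ?q) \<cdot>\<^sub>m P" .
  have can: "(a \<cdot>\<^sub>m (?A * P) + b \<cdot>\<^sub>m P) * P' = a \<cdot>\<^sub>m ?A + b \<cdot>\<^sub>m 1\<^sub>m N" for a b
  proof -
    have "(a \<cdot>\<^sub>m (?A * P) + b \<cdot>\<^sub>m P) * P' = ((a \<cdot>\<^sub>m ?A + b \<cdot>\<^sub>m 1\<^sub>m N) * P) * P'"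
      by (simp only: smult_add_one_mult(1)[OF cA P(2)])
    also have "\<dots> = (a \<cdot>\<^sub>m ?A + b \<cdot>\<^sub>m 1\<^sub>m N) * (P * P')"
      using cA P(2,3) by (intro assoc_mult_mat) auto
    also have "\<dots> = a \<cdot>\<^sub>m ?A + b \<cdot>\<^sub>m 1\<^sub>m N"
      unfolding P(4) using cA by (intro right_mult_one_mat) auto
    finally show ?thesis .
  qed
  \<comment> \<open>Removing \<open>P\<close> leaves a linear relation in which \<open>?A\<close>
    has the total coefficient (1 - c) (q - 1), nonzero for c distinct from 1.\<close>
  have scal: "(?q - 1) \<cdot>\<^sub>m ?A + ?q \<cdot>\<^sub>m 1\<^sub>m N = (c * (?q - 1)) \<cdot>\<^sub>m ?A + (c * c * ?q) \<cdot>\<^sub>m 1\<^sub>m N"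
    using arg_cong[OF eq, of "\<lambda>M. M * P'"] unfolding can .
  let ?g = "gen_coeff z p"
  have off: "?g w u = 0" if u: "u \<in> set T" "u \<noteq> w" for u
  proof -
    obtain a b where ab: "a < N" "b < N" "T ! a = w" "T ! b = u"
      using w(1) u(1) unfolding in_set_conv_nth by blast
    have "a \<noteq> b" using ab u(2) by auto
    have "?A $$ (a, b) = ?g w u" using ab by (simp add: rho_eq_fmat fmat_def)
    then have "(?q - 1) * ?g w u = c * (?q - 1) * ?g w u"
      using arg_cong[OF scal, of "\<lambda>M. M $$ (a, b)"] ab(1,2) \<open>a \<noteq> b\<close> cA by simp
    then have "(1 - c) * (?q - 1) * ?g w u = 0" by (simp add: algebra_simps)
    then show ?thesis using c z_sq(1) by simp
  qed
  \<comment> \<open>With the row of \<open>w\<close> diagonal, the quadratic relation makes its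
    diagonal entry q or -1. These values mean X = 1/q and X = q, which the choice of the step
    excludes.\<close>
  have "(\<Sum>u\<in>set T. ?g w u * ?g u w) = (\<Sum>u\<in>{w}. ?g w u * ?g u w)"
    using off w(1) by (intro sum.mono_neutral_right) auto
  then have "?g w w * ?g w w = (?q - 1) * ?g w w + ?q"
    using gen_coeff_quadratic[OF w(1,1,2)] by simp
  then have "(?g w w - ?q) * (?g w w + 1) = 0" by (simp add: algebra_simps)
  then have "?g w w = ?q \<or> ?g w w = -1" by (auto simp: add_eq_0_iff2)
  moreover have "?g w w * (step_ratio w p - 1) = 1 - ?q"
    using gen_coeff_diag[OF w(1,2)] step_ratio_neq[OF w(1,2)] by simp
  ultimately have "?q * (step_ratio w p - 1) = 1 - ?q \<or> - (step_ratio w p - 1) = 1 - ?q" by auto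
  then have "?q * step_ratio w p = 1 \<or> step_ratio w p = ?q" by (auto simp: algebra_simps)
  then show False using w(3,4) z_nonzero by (auto simp: field_simps)
qed

lemma twisted_equiv_imp_eq:
  assumes S: "sector r z k' lam' n"
    and equiv: "rep_equiv n N (rho z k r lam) (length (tabs k' r lam')) (tensor_char psi (rho z k' r lam'))"
    and psi: "\<And>i. i \<in> {1..<n} \<Longrightarrow> psi i = c"
    and nt: "\<not> trivial_type k r lam"
  shows "lam = lam'"
proof -
  interpret C: sector r z k' lam' n by fact
  obtain P P' where N: "N = C.N" and P: "P \<in> carrier_mat C.N C.N" "P' \<in> carrier_mat C.N C.N"
    "P * P' = 1\<^sub>m C.N" and PP: "\<And>i. i \<in> {1..<n} \<Longrightarrow> rho z k r lam i * P = P * tensor_char psi (rho z k' r lam') i"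
    using rep_equivE[OF equiv] by metis
  note P = P[folded N]
  have int_c: "R p * P = P * (c \<cdot>\<^sub>m C.R p)" if "Suc p < n" for p
    using PP[of "Suc p"] psi[of "Suc p"] that by (simp add: tensor_char_def)
  have "c = 1" by (rule twist_trivial[OF S N[symmetric] P int_c nt])
  then have int1: "R p * P = P * C.R p" if "Suc p < n" for p
    using int_c[OF that] by (simp add: one_smult_mat)
  have cC: "C.R p \<in> carrier_mat N N" "C.JM p \<in> carrier_mat N N" for p
    using C.R_carrier[of p] C.JM_carrier[of p] unfolding N by auto
  have JM: "JM p * P = P * C.JM p" if "p < n" for p
    using that
  proof (induction p)
    case 0
    then show ?case using JM_0 C.JM_0 P(1) N by (metis left_mult_one_mat right_mult_one_mat)
  next
    case (Suc p)
    then have IH: "JM p * P = P * C.JM p" by simp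
    note as = assoc_mult_mat[of _ N N _ N _ N] mult_carrier_mat[of _ N N _ N]
    have "z\<^sup>2 \<cdot>\<^sub>m (JM (Suc p) * P) = (R p * (JM p * R p)) * P"
      using JM_Suc[OF Suc.prems] P(1) by (simp add: mult_smult_assoc_mat[of _ N N _ N])
    also have "\<dots> = R p * (JM p * (R p * P))" using P(1) by (simp add: as)
    also have "\<dots> = R p * ((JM p * P) * C.R p)"
      using int1[OF Suc.prems] P(1) cC by (simp add: as)
    also have "\<dots> = (R p * P) * (C.JM p * C.R p)"
      unfolding IH using P(1) cC by (simp add: as)
    also have "\<dots> = P * (C.R p * (C.JM p * C.R p))"
      unfolding int1[OF Suc.prems] using P(1) cC by (simp add: as)
    also have "\<dots> = z\<^sup>2 \<cdot>\<^sub>m (P * C.JM (Suc p))"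
      unfolding C.JM_Suc[OF Suc.prems] using P(1) cC by (simp add: mult_smult_distrib[of _ N N _ N])
    finally have "(1 / z\<^sup>2) \<cdot>\<^sub>m (z\<^sup>2 \<cdot>\<^sub>m (JM (Suc p) * P)) = (1 / z\<^sup>2) \<cdot>\<^sub>m (z\<^sup>2 \<cdot>\<^sub>m (P * C.JM (Suc p)))"
      by simp
    then show ?case using z_nonzero by (simp add: smult_smult_mat one_smult_mat)
  qed
  \<comment> \<open>There is at least one tableau, so a zero \<open>P\<close> could not have an
    inverse.\<close>
  obtain a b where ab: "a < N" "b < N" "P $$ (a, b) \<noteq> 0"
  proof (rule ccontr)
    assume "\<not> thesis"
    then have "P = 0\<^sub>m N N" using that P(1) by (intro eq_matI) auto
    then have "0\<^sub>m N N = (1\<^sub>m N :: complex mat)" using P(2,3) by simp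
    then have "(0\<^sub>m N N :: complex mat) $$ (0, 0) = 1\<^sub>m N $$ (0, 0)" by simp
    then show False using T_nonempty by simp
  qed
  let ?v = "T ! a" and ?w = "C.T ! b"
  have v: "?v \<in> set T" and w: "?w \<in> set C.T" using ab N by auto
  have "?v = ?w"
  proof (rule path_eqI[of k r _ k'])
    fix p assume "p < length ?w"
    then have p: "p < n" using C.T_length[OF w] by simp
    have "Q (ct ?v p) * P $$ (a, b) = (JM p * P) $$ (a, b)"
      using ab P(1) by (simp add: JM_def mat_diag_mult_left[of _ N N])
    also have "\<dots> = (P * C.JM p) $$ (a, b)" by (simp only: JM[OF p])
    also have "\<dots> = P $$ (a, b) * Q (ct ?w p)"
      using ab P(1) unfolding C.JM_def N[symmetric] by (simp add: mat_diag_mult_right[of _ N N])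
    finally show "int r dvd ct ?v p - ct ?w p" using ab(3) Q_eq_iff by simp
  qed (use v w T_iff C.T_iff kr C.kr T_length C.T_length in auto)
  then have "rowlen lam j = rowlen lam' j" for j
    using v w unfolding T_iff C.T_iff has_shape_def by metis
  then show ?thesis using young_lam C.young_lam by (intro rowlen_eqI) (auto simp: young_def)
qed

end

theorem theorem3p5:
  fixes r n k1 k2 :: nat and q12 :: complex and lam1 lam2 :: "nat list"
  assumes "r > 4"
    and "q12 = cis (pi / real r) \<or> q12 = cis (- pi / real r)"
    and "1 < k1" "k1 < r - 1" "1 < k2" "k2 < r - 1"
    and "lam1 \<in> Lambda n k1 r" "lam2 \<in> Lambda n k2 r"
    and "\<not> trivial_type k1 r lam1" "\<not> trivial_type k2 r lam2"
  shows "((\<exists>psi. braid_character n psi \<and>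
             rep_equiv n (length (tabs k1 r lam1)) (rho q12 k1 r lam1)
               (length (tabs k2 r lam2)) (tensor_char psi (rho q12 k2 r lam2)))
          \<longleftrightarrow> lam1 = lam2)
       \<and> ((\<exists>psi. braid_character n psi \<and>
             rep_equiv n (length (tabs k1 r lam1)) (rho q12 k1 r lam1)
               (length (tabs k2 r lam2)) (tensor_char psi (contragredient (rho q12 k2 r lam2))))
          \<longleftrightarrow> lam1 = r_conj k2 r lam2)"
proof -
  have sec: "sector r q12 k lam n" if "1 < k" "k < r - 1" "lam \<in> Lambda n k r" for k lam
  proof
    have "kr_admissible k r lam" "sum_list lam = n" using that by (auto simp: Lambda_def)
    then show "young lam" "sum_list lam = n" by (auto simp: kr_admissible_def)
    then show "adm_fun k r (rowlen lam)"
      using kr_admissible_iff[of lam k r] \<open>kr_admissible k r lam\<close> that by simp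
  qed (use assms(1,2) that in auto)
  interpret S1: sector r q12 k1 lam1 n by (rule sec) fact+
  interpret S2: sector r q12 k2 lam2 n by (rule sec) fact+
  let ?A = "rho q12 k1 r lam1" and ?C = "contragredient (rho q12 k2 r lam2)"
  let ?mu = "r_conj k2 r lam2"
  interpret S3: sector r q12 "r - k2" ?mu n by (rule S2.sector_conj)
  have cC: "?C i \<in> carrier_mat S2.N S2.N" if "i \<in> {1..<n}" for i
  proof -
    have i: "Suc (i - 1) = i" "Suc (i - 1) < n" using that by auto
    show ?thesis unfolding S2.contragredient_eq[OF i(2), unfolded i(1)] by (rule fmat_carrier)
  qed
  have "lam1 = lam2" if psi: "braid_character n psi"
    and equiv: "rep_equiv n S1.N ?A S2.N (tensor_char psi (rho q12 k2 r lam2))" for psi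
  proof -
    obtain c where "\<And>i. i \<in> {1..<n} \<Longrightarrow> psi i = c" using braid_character_eq_const[OF psi] by blast
    then show ?thesis
      by (rule S1.twisted_equiv_imp_eq[OF S2.sector_axioms equiv _ assms(9)])
  qed
  moreover have "\<exists>psi. braid_character n psi \<and>
      rep_equiv n S1.N ?A S2.N (tensor_char psi (rho q12 k2 r lam2))" if "lam1 = lam2"
  proof (intro exI conjI)
    show "braid_character n (\<lambda>_. 1)" by (rule braid_character_const) simp
    show "rep_equiv n S1.N ?A S2.N (tensor_char (\<lambda>_. 1) (rho q12 k2 r lam2))"
      using S1.rep_equiv_change_width[of k2] S2.sector_axioms that by simp
  qed
  moreover have "lam1 = ?mu" if psi: "braid_character n psi"
    and equiv: "rep_equiv n S1.N ?A S2.N (tensor_char psi ?C)" for psi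
  proof -
    obtain c where c: "\<And>i. i \<in> {1..<n} \<Longrightarrow> psi i = c" using braid_character_eq_const[OF psi] by blast
    \<comment> \<open>\<open>rep_equiv_conj\<close> is read backwards, which inverts its factor -q.
      The combined twist is again constant, so the argument of the first equivalence applies to the
      conjugate sector of width \<open>r - k2\<close>.\<close>
    have "rep_equiv n S2.N ?C S3.N (tensor_char (\<lambda>_. 1 / (- q12\<^sup>2)) (rho q12 (r - k2) r ?mu))"
      using S1.z_nonzero
      by (intro rep_equiv_twist_sym[OF S2.rep_equiv_conj] cC) (auto simp: rho_carrier)
    then have "rep_equiv n S1.N ?A S3.N
        (tensor_char (\<lambda>i. psi i * (1 / (- q12\<^sup>2))) (rho q12 (r - k2) r ?mu))"
      by (intro rep_equiv_twist_trans[OF equiv] cC) (auto simp: rho_carrier)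
    then show ?thesis
      by (rule S1.twisted_equiv_imp_eq[OF S3.sector_axioms _ _ assms(9)]) (simp add: c)
  qed
  moreover have "\<exists>psi. braid_character n psi \<and> rep_equiv n S1.N ?A S2.N (tensor_char psi ?C)"
    if "lam1 = ?mu"
  proof (intro exI conjI)
    \<comment> \<open>The factor -q comes from \<open>rep_equiv_conj\<close>, the factor 1 from the
      passage between the widths \<open>k1\<close> and \<open>r - k2\<close>.\<close>
    show "braid_character n (\<lambda>_. 1 * - q12\<^sup>2)"
      using S1.z_nonzero by (intro braid_character_const) simp
    have "rep_equiv n S1.N ?A S3.N (tensor_char (\<lambda>_. 1) (rho q12 (r - k2) r ?mu))"
      using S1.rep_equiv_change_width[of "r - k2"] S3.sector_axioms that by simp
    then show "rep_equiv n S1.N ?A S2.N (tensor_char (\<lambda>_. 1 * - q12\<^sup>2) ?C)"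
      by (rule rep_equiv_twist_trans[OF _ S2.rep_equiv_conj]) (auto simp: rho_carrier cC)
  qed
  ultimately show ?thesis by blast
qed

end
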